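(* For all $f_1,\dots,f_{n-2}\in C^\infty(\Sigma)$ and $A=1,\dots,p$ it holds that $$\gamma^2\,\mathcal{C}_A(f_1,\dots,f_{n-2})=(\mathcal{P}^2)^i_j\Big[\{x^k,\bar\Gamma^j_{kj'}\}_f-\{x^k,x^l\}_f\,\bar\Gamma^m_{lj'}\bar\Gamma^j_{km}\Big]n_A^{j'}\,\partial_i,$$ where $\{g_1,g_2\}_f=\{g_1,g_2,f_1,\dots,f_{n-2}\}$ (for $n=2$ there are no functions $f_i$ and $\{\cdot,\cdot\}_f=\{\cdot,\cdot\}$).
   Context: Setting: $n\ge 2$, $p\ge1$, $\Sigma$ is an $n$-dimensional manifold embedded in a Riemannian manifold $(M,\bar g)$ of dimension $n+p$. $x^1,\dots,x^{n+p}$ are local coordinates on $M$, $u^1,\dots,u^n$ local coordinates on $\Sigma$; the $x^i$ are regarded as functions of the $u^a$ (the embedding), and $\partial_a=\partial/\partial u^a$. Repeated indices are summed ($i,j,j',k,l,m$ from $1$ to $n+p$; $a,b,a_i$ from $1$ to $n$). $e_a=(\partial_ax^i)\partial_i$ is the basis of $T\Sigma\subset TM$, $g_{ab}=\bar g(e_a,e_b)$, $g=\det(g_{ab})$, $(g^{ab})$ the inverse of $(g_{ab})$. $N_A=n_A^i\partial_i$, $A=1,\dots,p$, are (local, smooth) normal vector fields along $\Sigma$ with $\bar g(N_A,N_B)=\delta_{AB}$. $\nabla$, $\bar\nabla$ are the Levi-Civita connections of $\Sigma$, $M$; $\bar\Gamma^i_{jk}$ are the Christoffel symbols of $M$ (restricted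 to $\Sigma$ they are functions of $u^1,\dots,u^n$). For $X,Y\in T\Sigma$: $\bar\nabla_XY=\nabla_XY+\sum_Ah_A(X,Y)N_A$ and $\bar\nabla_XN_A=-W_A(X)+D_XN_A$ with $W_A(X)\in T\Sigma$, $D_XN_A\in T\Sigma^\perp$. Define $$\mathcal{W}_A(X,Y)=(\nabla_XW_A)(Y)-(\nabla_YW_A)(X)+\sum_{B=1}^p\big[\bar g(D_XN_B,N_A)W_B(Y)-\bar g(D_YN_B,N_A)W_B(X)\big].$$ $\rho$ is an arbitrary non-vanishing density on $\Sigma$, $\{f_1,\dots,f_n\}=\frac1\rho\varepsilon^{a_1\cdots a_n}(\partial_{a_1}f_1)\cdots(\partial_{a_n}f_n)$ with $\varepsilon$ the Levi-Civita symbol ($\varepsilon^{12\cdots n}=1$), and $\gamma=\sqrt g/\rho$. The maps $\mathcal{C}_A:C^\infty(\Sigma)\times\cdots\times C^\infty(\Sigma)\to T\Sigma$ are $$\mathcal{C}_A(f_1,\dots,f_{n-2})=\frac{1}{2\rho}\varepsilon^{aba_1\cdots a_{n-2}}\mathcal{W}_A(e_a,e_b)(\partial_{a_1}f_1)\cdots(\partial_{a_{n-2}}f_{n-2})\quad(n\ge3),$$ and $\mathcal{C}_A=\frac{1}{2\rho}\varepsilon^{ab}\mathcal{W}_A(e_a,e_b)$ for $n=2$. For multi-indices $I=i_1\cdots i_{n-1}$, $J=j_1\cdots j_{n-1}$: $\mathcal{P}^{iJ}=\frac{1}{\sqrt{(n-1)!}}\{x^i,x^{j_1},\dots,x^{j_{n-1}}\}$,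 $\bar g_{IJ}=\bar g_{i_1j_1}\cdots\bar g_{i_{n-1}j_{n-1}}$, $(\mathcal{P}^2)^{ik}=\mathcal{P}^{iI}\mathcal{P}^{kJ}\bar g_{IJ}$ and $(\mathcal{P}^2)^i_j=(\mathcal{P}^2)^{ik}\bar g_{kj}$. *)

theory Defs
  imports "HOL-Analysis.Analysis" "HOL-Combinatorics.Permutations"
begin

section \<open>Smooth functions on open subsets of Euclidean space\<close>

primrec Ck_on :: "nat \<Rightarrow> 'a::real_normed_vector set \<Rightarrow> ('a \<Rightarrow> 'b::real_normed_vector) \<Rightarrow> bool" where
  "Ck_on 0 S f \<longleftrightarrow> continuous_on S f"
| "Ck_on (Suc k) S f \<longleftrightarrow>
     (\<forall>z\<in>S. f differentiable (at z)) \<and> (\<forall>v. Ck_on k S (\<lambda>z. frechet_derivative f (at z) v))"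

text \<open>Only meaningful for open \<open>S\<close>, since derivatives are taken in the ambient space.\<close>

definition smooth_on :: "'a::real_normed_vector set \<Rightarrow> ('a \<Rightarrow> 'b::real_normed_vector) \<Rightarrow> bool" where
  "smooth_on S f \<longleftrightarrow> (\<forall>k. Ck_on k S f)"

definition pd :: "'k \<Rightarrow> (real^'k \<Rightarrow> 'b::real_normed_vector) \<Rightarrow> real^'k \<Rightarrow> 'b" where
  "pd a f u = frechet_derivative f (at u) (axis a 1)"


section \<open>Manifolds, Riemannian metrics, embeddings\<close>

text \<open>
  A manifold is a Hausdorff, second countable type with a smooth atlas. A chart is a pair of its
  domain and its coordinate map.
\<close>

type_synonym 'k coords = "real^'k"

type_synonym ('a, 'k) chart = "'a set \<times> ('a \<Rightarrow> 'k coords)"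

definition chart_inv :: "('a, 'k) chart \<Rightarrow> real^'k \<Rightarrow> 'a" where
  "chart_inv c = inv_into (fst c) (snd c)"

definition is_chart :: "('a::topological_space, 'k::finite) chart \<Rightarrow> bool" where
  "is_chart c \<longleftrightarrow> open (fst c) \<and> open (snd c ` fst c) \<and>
     homeomorphism (fst c) (snd c ` fst c) (snd c) (chart_inv c)"

definition smooth_atlas :: "('a::topological_space, 'k::finite) chart set \<Rightarrow> bool" where
  "smooth_atlas \<A> \<longleftrightarrow> (\<forall>c\<in>\<A>. is_chart c) \<and> (\<Union>c\<in>\<A>. fst c) = UNIV \<and>
     (\<forall>c\<in>\<A>. \<forall>c'\<in>\<A>. smooth_on (snd c ` (fst c \<inter> fst c')) (snd c' \<circ> chart_inv c))"

definition smooth_function :: "('a, 'k::finite) chart set \<Rightarrow> ('a \<Rightarrow> real) \<Rightarrow> bool" where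
  "smooth_function \<A> f \<longleftrightarrow> (\<forall>c\<in>\<A>. smooth_on (snd c ` fst c) (f \<circ> chart_inv c))"

text \<open>
  A Riemannian metric is given by its component matrices \<open>G c z\<close> in each chart \<open>c\<close>, as functions of
  the coordinates \<open>z\<close>, subject to the transformation law of a covariant 2-tensor.
\<close>

definition riemannian_metric ::
    "('a, 'k::finite) chart set \<Rightarrow> (('a, 'k) chart \<Rightarrow> real^'k \<Rightarrow> real^'k^'k) \<Rightarrow> bool" where
  "riemannian_metric \<A> G \<longleftrightarrow>
     (\<forall>c\<in>\<A>. smooth_on (snd c ` fst c) (G c) \<and>
        (\<forall>z\<in>snd c ` fst c. transpose (G c z) = G c z \<and> (\<forall>v. v \<noteq> 0 \<longrightarrow> v \<bullet> (G c z *v v) > 0))) \<and>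
     (\<forall>c\<in>\<A>. \<forall>c'\<in>\<A>. \<forall>z\<in>snd c ` (fst c \<inter> fst c').
        let \<tau> = snd c' \<circ> chart_inv c; J = matrix (frechet_derivative \<tau> (at z))
        in G c z = transpose J ** G c' (\<tau> z) ** J)"

definition overlap :: "('s \<Rightarrow> 'a) \<Rightarrow> ('s, 'n) chart \<Rightarrow> ('a, 'k) chart \<Rightarrow> (real^'n) set" where
  "overlap \<iota> d c = snd d ` (fst d \<inter> \<iota> -` fst c)"

definition coord_rep :: "('s \<Rightarrow> 'a) \<Rightarrow> ('s, 'n) chart \<Rightarrow> ('a, 'k) chart \<Rightarrow> real^'n \<Rightarrow> real^'k" where
  "coord_rep \<iota> d c = snd c \<circ> \<iota> \<circ> chart_inv d"

definition smooth_embedding ::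
    "('s::topological_space, 'n::finite) chart set \<Rightarrow> ('a::topological_space, 'k::finite) chart set
     \<Rightarrow> ('s \<Rightarrow> 'a) \<Rightarrow> bool" where
  "smooth_embedding \<S> \<M> \<iota> \<longleftrightarrow> (\<exists>\<kappa>. homeomorphism UNIV (range \<iota>) \<iota> \<kappa>) \<and>
     (\<forall>d\<in>\<S>. \<forall>c\<in>\<M>. smooth_on (overlap \<iota> d c) (coord_rep \<iota> d c) \<and>
        (\<forall>u\<in>overlap \<iota> d c. inj (frechet_derivative (coord_rep \<iota> d c) (at u))))"


section \<open>Levi-Civita connections in local coordinates\<close>

definition ip :: "real^'k^'k \<Rightarrow> real^'k \<Rightarrow> real^'k \<Rightarrow> real" where
  "ip g v w = (\<Sum>i\<in>UNIV. \<Sum>j\<in>UNIV. g $ i $ j * v $ i * w $ j)"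

text \<open>\<open>christoffel G i j k z\<close> is $\Gamma^i_{jk}$ at $z$.\<close>

definition christoffel :: "(real^'k \<Rightarrow> real^'k^'k) \<Rightarrow> 'k::finite \<Rightarrow> 'k \<Rightarrow> 'k \<Rightarrow> real^'k \<Rightarrow> real" where
  "christoffel G i j k z = 1/2 * (\<Sum>l\<in>UNIV. matrix_inv (G z) $ i $ l *
     (pd j (\<lambda>y. G y $ l $ k) z + pd k (\<lambda>y. G y $ l $ j) z - pd l (\<lambda>y. G y $ j $ k) z))"

definition covariant_derivative ::
    "(real^'n \<Rightarrow> real^'n^'n) \<Rightarrow> real^'n \<Rightarrow> (real^'n \<Rightarrow> real^'n) \<Rightarrow> real^'n \<Rightarrow> real^'n::finite" where
  "covariant_derivative g X Y u = (\<chi> c. \<Sum>a\<in>UNIV. X $ a *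
     (pd a Y u $ c + (\<Sum>b\<in>UNIV. christoffel g c a b u * Y u $ b)))"

text \<open>
  From here on, \<open>x\<close> expresses the coordinates of \<open>M\<close> as functions of the coordinates \<open>u\<close> of \<open>\<Sigma>\<close>,
  and \<open>G\<close> is the metric of \<open>M\<close> in the chosen coordinates. Vectors tangent to \<open>\<Sigma>\<close> are given by their
  components with respect to $e_a$, and \<open>pushforward\<close> views them as vectors tangent to \<open>M\<close>, with
  components with respect to $\partial_i$. Vector fields of \<open>M\<close> along \<open>\<Sigma>\<close>, in particular the normal
  fields \<open>N A\<close>, are given by their components with respect to $\partial_i$.
\<close>

definition pushforward :: "(real^'n::finite \<Rightarrow> real^'m::finite) \<Rightarrow> real^'n \<Rightarrow> real^'n \<Rightarrow> real^'m" where
  "pushforward x u X = (\<Sum>a\<in>UNIV. X $ a *\<^sub>R pd a x u)"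

definition induced_metric ::
    "(real^'m \<Rightarrow> real^'m^'m) \<Rightarrow> (real^'n::finite \<Rightarrow> real^'m::finite) \<Rightarrow> real^'n \<Rightarrow> real^'n^'n" where
  "induced_metric G x u = (\<chi> a b. ip (G (x u)) (pd a x u) (pd b x u))"

definition covariant_derivative_along ::
    "(real^'m \<Rightarrow> real^'m^'m) \<Rightarrow> (real^'n::finite \<Rightarrow> real^'m::finite) \<Rightarrow> real^'n \<Rightarrow> (real^'n \<Rightarrow> real^'m)
     \<Rightarrow> real^'n \<Rightarrow> real^'m" where
  "covariant_derivative_along G x X V u = (\<chi> i. \<Sum>a\<in>UNIV. X $ a *
     (pd a V u $ i +
      (\<Sum>j\<in>UNIV. \<Sum>k\<in>UNIV. christoffel G i j k (x u) * pd a x u $ j * V u $ k)))"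

definition normal_vector ::
    "(real^'m \<Rightarrow> real^'m^'m) \<Rightarrow> (real^'n::finite \<Rightarrow> real^'m::finite) \<Rightarrow> real^'n \<Rightarrow> real^'m \<Rightarrow> bool" where
  "normal_vector G x u v \<longleftrightarrow> (\<forall>X. ip (G (x u)) v (pushforward x u X) = 0)"

definition orthonormal_normal_fields ::
    "(real^'m \<Rightarrow> real^'m^'m) \<Rightarrow> (real^'n::finite \<Rightarrow> real^'m::finite) \<Rightarrow> ('p \<Rightarrow> real^'n \<Rightarrow> real^'m)
     \<Rightarrow> (real^'n) set \<Rightarrow> bool" where
  "orthonormal_normal_fields G x N V \<longleftrightarrow>
     (\<forall>A. smooth_on V (N A)) \<and>
     (\<forall>u\<in>V. (\<forall>A. normal_vector G x u (N A u)) \<and>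
            (\<forall>A B. ip (G (x u)) (N A u) (N B u) = (if A = B then 1 else 0)))"


section \<open>The Weingarten maps and the normal connection\<close>

definition weingarten ::
    "(real^'m \<Rightarrow> real^'m^'m) \<Rightarrow> (real^'n::finite \<Rightarrow> real^'m::finite) \<Rightarrow> ('p \<Rightarrow> real^'n \<Rightarrow> real^'m)
     \<Rightarrow> 'p \<Rightarrow> real^'n \<Rightarrow> real^'n \<Rightarrow> real^'n" where
  "weingarten G x N A X u = (THE w. \<exists>v. normal_vector G x u v \<and>
     covariant_derivative_along G x X (N A) u = - pushforward x u w + v)"

definition normal_connection ::
    "(real^'m \<Rightarrow> real^'m^'m) \<Rightarrow> (real^'n::finite \<Rightarrow> real^'m::finite) \<Rightarrow> ('p \<Rightarrow> real^'n \<Rightarrow> real^'m)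
     \<Rightarrow> 'p \<Rightarrow> real^'n \<Rightarrow> real^'n \<Rightarrow> real^'m" where
  "normal_connection G x N A X u = (THE v. normal_vector G x u v \<and>
     (\<exists>w. covariant_derivative_along G x X (N A) u = - pushforward x u w + v))"

text \<open>$(\nabla_X W_A)(Y)$\<close>

definition nabla_weingarten ::
    "(real^'m \<Rightarrow> real^'m^'m) \<Rightarrow> (real^'n::finite \<Rightarrow> real^'m::finite) \<Rightarrow> ('p \<Rightarrow> real^'n \<Rightarrow> real^'m)
     \<Rightarrow> 'p \<Rightarrow> (real^'n \<Rightarrow> real^'n) \<Rightarrow> (real^'n \<Rightarrow> real^'n) \<Rightarrow> real^'n \<Rightarrow> real^'n" where
  "nabla_weingarten G x N A X Y u =
     covariant_derivative (induced_metric G x) (X u) (\<lambda>v. weingarten G x N A (Y v) v) u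
     - weingarten G x N A (covariant_derivative (induced_metric G x) (X u) Y u) u"

definition curly_W ::
    "(real^'m \<Rightarrow> real^'m^'m) \<Rightarrow> (real^'n::finite \<Rightarrow> real^'m::finite)
     \<Rightarrow> ('p::finite \<Rightarrow> real^'n \<Rightarrow> real^'m)
     \<Rightarrow> 'p \<Rightarrow> (real^'n \<Rightarrow> real^'n) \<Rightarrow> (real^'n \<Rightarrow> real^'n) \<Rightarrow> real^'n \<Rightarrow> real^'n" where
  "curly_W G x N A X Y u =
     nabla_weingarten G x N A X Y u - nabla_weingarten G x N A Y X u +
     (\<Sum>B\<in>UNIV.
        ip (G (x u)) (normal_connection G x N B (X u) u) (N A u) *\<^sub>R weingarten G x N B (Y u) u
      - ip (G (x u)) (normal_connection G x N B (Y u) u) (N A u) *\<^sub>R weingarten G x N B (X u) u)"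


section \<open>The Levi-Civita symbol and the multi-linear bracket\<close>

text \<open>
  A multi-index is a list of indices. The linear order of the index type \<open>'n\<close> is the numbering
  $u^1,\dots,u^n$ of the coordinates of \<open>\<Sigma>\<close>.
\<close>

definition levi_civita :: "'n::{finite, linorder} list \<Rightarrow> real" where
  "levi_civita as =
     (if length as = CARD('n) \<and> distinct as
      then of_int (sign (THE \<sigma>. map \<sigma> (sorted_list_of_set UNIV) = as)) else 0)"

lemma levi_civita_sorted: "levi_civita (sorted_list_of_set (UNIV :: 'n::{finite, linorder} set)) = 1"
proof -
  have "\<sigma> = id" if "map \<sigma> (sorted_list_of_set (UNIV :: 'n set)) = sorted_list_of_set UNIV" for \<sigma>
  proof
    fix a :: 'n
    have "a \<in> set (sorted_list_of_set UNIV)" by simp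
    moreover have "map \<sigma> (sorted_list_of_set UNIV) = map id (sorted_list_of_set UNIV)"
      using that by simp
    ultimately show "\<sigma> a = id a" by (metis map_eq_conv)
  qed
  then have "(THE \<sigma>. map \<sigma> (sorted_list_of_set (UNIV :: 'n set)) = sorted_list_of_set UNIV) = id"
    by (intro the_equality) auto
  then show ?thesis
    by (simp add: levi_civita_def)
qed

text \<open>
  In the definitions below \<open>\<rho>\<close> is the component of a density of \<open>\<Sigma>\<close> in the coordinates \<open>u\<close>, and
  functions on \<open>\<Sigma>\<close> are written in these coordinates.
\<close>

definition multi_indices :: "nat \<Rightarrow> 'k list set" where
  "multi_indices r = {I. length I = r}"

definition bracket :: "('n::{finite, linorder} coords \<Rightarrow> real) \<Rightarrow> ('n coords \<Rightarrow> real) list \<Rightarrow> 'n coords \<Rightarrow> real" where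
  "bracket \<rho> fs u = 1 / \<rho> u *
     (\<Sum>as\<in>multi_indices CARD('n). levi_civita as * (\<Prod>r<CARD('n). pd (as ! r) (fs ! r) u))"

definition gamma :: "(real^'m \<Rightarrow> real^'m^'m) \<Rightarrow> ('n::finite coords \<Rightarrow> real^'m::finite) \<Rightarrow>
    ('n coords \<Rightarrow> real) \<Rightarrow> 'n coords \<Rightarrow> real" where
  "gamma G x \<rho> u = sqrt (det (induced_metric G x u)) / \<rho> u"

definition curly_C ::
    "(real^'m \<Rightarrow> real^'m^'m) \<Rightarrow> ('n::{finite, linorder} coords \<Rightarrow> real^'m::finite)
     \<Rightarrow> ('p::finite \<Rightarrow> 'n coords \<Rightarrow> real^'m) \<Rightarrow> ('n coords \<Rightarrow> real)
     \<Rightarrow> 'p \<Rightarrow> ('n coords \<Rightarrow> real) list \<Rightarrow> 'n coords \<Rightarrow> 'n coords" where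
  "curly_C G x N \<rho> A fs u = (1 / (2 * \<rho> u)) *\<^sub>R
     (\<Sum>a\<in>UNIV. \<Sum>b\<in>UNIV. \<Sum>as\<in>multi_indices (CARD('n) - 2).
        (levi_civita (a # b # as) * (\<Prod>r<CARD('n) - 2. pd (as ! r) (fs ! r) u)) *\<^sub>R
        curly_W G x N A (\<lambda>_. axis a 1) (\<lambda>_. axis b 1) u)"

text \<open>$\mathcal{P}^{iJ}$, $(\mathcal{P}^2)^{ik}$ and $(\mathcal{P}^2)^i_j$\<close>

definition curly_P ::
    "('n::{finite, linorder} coords \<Rightarrow> real^'m) \<Rightarrow> ('n coords \<Rightarrow> real) \<Rightarrow> 'm \<Rightarrow> 'm list \<Rightarrow> 'n coords \<Rightarrow> real" where
  "curly_P x \<rho> i J u = 1 / sqrt (fact (CARD('n) - 1)) * bracket \<rho> (map (\<lambda>j v. x v $ j) (i # J)) u"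

definition P2_upper ::
    "(real^'m \<Rightarrow> real^'m^'m) \<Rightarrow> ('n::{finite, linorder} coords \<Rightarrow> real^'m::finite) \<Rightarrow> ('n coords \<Rightarrow> real)
     \<Rightarrow> 'm \<Rightarrow> 'm \<Rightarrow> 'n coords \<Rightarrow> real" where
  "P2_upper G x \<rho> i k u =
     (\<Sum>I\<in>multi_indices (CARD('n) - 1). \<Sum>J\<in>multi_indices (CARD('n) - 1).
        curly_P x \<rho> i I u * curly_P x \<rho> k J u * (\<Prod>r<CARD('n) - 1. G (x u) $ (I ! r) $ (J ! r)))"

definition P2_mixed ::
    "(real^'m \<Rightarrow> real^'m^'m) \<Rightarrow> ('n::{finite, linorder} coords \<Rightarrow> real^'m::finite) \<Rightarrow> ('n coords \<Rightarrow> real)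
     \<Rightarrow> 'm \<Rightarrow> 'm \<Rightarrow> 'n coords \<Rightarrow> real" where
  "P2_mixed G x \<rho> i j u = (\<Sum>k\<in>UNIV. P2_upper G x \<rho> i k u * G (x u) $ k $ j)"

end

theory Submission
  imports Defs
begin

text \<open>
  The identity is the Codazzi-Mainardi equation of the submanifold, written without reference to
  the tangent frame.

  Along the submanifold the covariant derivative of the ambient space in the direction $e_a$ is
  $D_a = \partial_a + A_a$, where $A_a$ is the matrix $(A_a)^j_{j'} = (\partial_a x^k)\bar\Gamma^j_{kj'}$.
  Both brackets on the right-hand side are contractions of the same antisymmetric coefficients
  $T^{ab}$ (\<open>bracket_tensor\<close>), which contain the $f_i$ and the density. Since the second derivatives of
  $x$ are symmetric, antisymmetrizing $(\partial_a x^k)\,\partial_b\bar\Gamma^j_{kj'} - (A_aA_b)^j_{j'}$ in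
  $a,b$ yields the negative of the curvature matrix $[D_a, D_b]$ (\<open>curvature_christoffel\<close>). So the
  square bracket applied to $N_A$ is $-\frac12 T^{ab}[D_a,D_b]N_A$.

  The tangential part of $[D_a,D_b]N_A$ is $-\mathcal{W}_A(e_a,e_b)$ (\<open>codazzi\<close>): decompose
  $D_bN_A$ into its tangential part $-W_A(e_b)$ and its normal part, differentiate once more, and use
  that the tangential part of the ambient connection is the Levi-Civita connection of the induced
  metric. Hence the tangential part of $-\frac12 T^{ab}[D_a,D_b]N_A$ is
  $\frac12 T^{ab}\mathcal{W}_A(e_a,e_b) = \mathcal{C}_A$.

  Finally $\mathcal{P}^2$ is $\gamma^2$ times the orthogonal projection onto the tangent space
  (\<open>P2_mixed_projection\<close>). Contracting the trailing indices of two brackets with the ambient metric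
  leaves two Levi-Civita symbols contracted with $n-1$ copies of the induced metric $g$; that is the
  cofactor matrix of $g$, so it equals $(n-1)!\,\det(g)\,g^{-1}$ (\<open>levi_civita_cofactors\<close>). Applied to the
  vector above, the projection produces $\gamma^2\,\mathcal{C}_A$.
\<close>


section \<open>Partial derivatives\<close>

lemma pd_eqI: "(f has_derivative f') (at u) \<Longrightarrow> pd a f u = f' (axis a 1)"
  unfolding pd_def by (metis frechet_derivative_at)

lemma has_derivative_frechet:
  "f differentiable at u \<Longrightarrow> (f has_derivative frechet_derivative f (at u)) (at u)"
  by (simp add: frechet_derivative_works)

lemma pd_const: "pd a (\<lambda>_. c) u = 0"
  by (simp add: pd_def)

lemma pd_add:
  assumes "f differentiable at u" "g differentiable at u"
  shows "pd a (\<lambda>v. f v + g v) u = pd a f u + pd a g u"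
  using pd_eqI[OF has_derivative_add[OF assms[THEN has_derivative_frechet]]] by (simp add: pd_def)

lemma pd_minus:
  assumes "f differentiable at u"
  shows "pd a (\<lambda>v. - f v) u = - pd a f u"
  using pd_eqI[OF has_derivative_minus[OF assms[THEN has_derivative_frechet]]] by (simp add: pd_def)

lemma pd_mult:
  fixes f g :: "real^'n \<Rightarrow> real"
  assumes "f differentiable at u" "g differentiable at u"
  shows "pd a (\<lambda>v. f v * g v) u = pd a f u * g u + f u * pd a g u"
  using pd_eqI[OF has_derivative_mult[OF assms[THEN has_derivative_frechet]]] by (simp add: pd_def)

lemma pd_sum:
  assumes "\<And>i. i \<in> I \<Longrightarrow> f i differentiable at u"
  shows "pd a (\<lambda>v. \<Sum>i\<in>I. f i v) u = (\<Sum>i\<in>I. pd a (f i) u)"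
  using pd_eqI[OF has_derivative_sum[of I f "\<lambda>i. frechet_derivative (f i) (at u)" "at u"]]
    has_derivative_frechet[OF assms] by (simp add: pd_def)

lemma pd_component:
  fixes f :: "real^'n \<Rightarrow> 'b::real_normed_vector ^ 'm"
  assumes "f differentiable at u"
  shows "pd a (\<lambda>v. f v $ i) u = pd a f u $ i"
  using pd_eqI[OF bounded_linear.has_derivative[OF bounded_linear_vec_nth
        assms[THEN has_derivative_frechet], of i]] by (simp add: pd_def)

lemma differentiable_component:
  assumes "f differentiable at u"
  shows "(\<lambda>v. f v $ i) differentiable at u"
  using bounded_linear.has_derivative[OF bounded_linear_vec_nth] assms
  unfolding differentiable_def by blast

lemma pd_cong_open:
  assumes "open S" "u \<in> S" "\<And>v. v \<in> S \<Longrightarrow> f v = g v" and "f differentiable at u"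
  shows "pd a f u = pd a g u"
  unfolding pd_def
  using frechet_derivative_transform_within_open[OF assms(4,1,2)] assms(3) by metis

lemma differentiable_cong_open:
  assumes "open S" "u \<in> S" "\<And>v. v \<in> S \<Longrightarrow> f v = g v" and "f differentiable at u"
  shows "g differentiable at u"
  using assms has_derivative_transform_within_open unfolding differentiable_def by blast

lemma linear_axis_expansion:
  fixes L :: "real^'m \<Rightarrow> 'b::real_normed_vector"
  assumes "linear L"
  shows "L w = (\<Sum>k\<in>UNIV. w $ k *\<^sub>R L (axis k 1))"
proof -
  have "L w = L (\<Sum>k\<in>UNIV. w $ k *\<^sub>R axis k 1)"
    using basis_expansion[of w] by (simp add: scalar_mult_eq_scaleR)
  also have "\<dots> = (\<Sum>k\<in>UNIV. w $ k *\<^sub>R L (axis k 1))"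
    using assms by (simp add: linear_sum linear_cmul)
  finally show ?thesis .
qed

lemma pd_chain:
  fixes f :: "real^'m \<Rightarrow> real"
  assumes "x differentiable at u" "f differentiable at (x u)"
  shows "pd a (\<lambda>v. f (x v)) u = (\<Sum>k\<in>UNIV. pd k f (x u) * pd a x u $ k)"
proof -
  have "((f \<circ> x) has_derivative frechet_derivative f (at (x u)) \<circ> frechet_derivative x (at u)) (at u)"
    using assms by (intro diff_chain_at has_derivative_frechet)
  then have "pd a (\<lambda>v. f (x v)) u = frechet_derivative f (at (x u)) (pd a x u)"
    by (subst pd_eqI) (auto simp: o_def pd_def)
  also have "\<dots> = (\<Sum>k\<in>UNIV. pd a x u $ k *\<^sub>R pd k f (x u))"
    unfolding pd_def[of _ f]
    by (rule linear_axis_expansion) (simp add: assms(2) linear_frechet_derivative)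
  finally show ?thesis by (simp add: mult.commute)
qed

lemma differentiable_prod:
  fixes f :: "'i \<Rightarrow> 'a::real_normed_vector \<Rightarrow> real"
  assumes "\<And>i. i \<in> I \<Longrightarrow> f i differentiable at u"
  shows "(\<lambda>v. \<Prod>i\<in>I. f i v) differentiable at u"
  using assms by (induction I rule: infinite_finite_induct) auto

lemma differentiable_det:
  fixes M :: "'a::real_normed_vector \<Rightarrow> real^'k^'k"
  assumes "\<And>i j. (\<lambda>v. M v $ i $ j) differentiable at u"
  shows "(\<lambda>v. det (M v)) differentiable at u"
  unfolding det_def using assms
  by (intro differentiable_sum differentiable_mult differentiable_prod ballI) auto

lemma matrix_inv_cancel:
  fixes M :: "real^'k^'k"
  assumes "invertible M"
  shows "M ** matrix_inv M = mat 1" "matrix_inv M ** M = mat 1"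
  using someI_ex[OF assms[unfolded invertible_def]] by (simp_all add: matrix_inv_def)

text \<open>
  By Cramer's rule the entries of the inverse are quotients of determinants, hence rational functions
  of the entries of \<open>M\<close>.
\<close>

lemma differentiable_matrix_inv:
  fixes M :: "'a::real_normed_vector \<Rightarrow> real^'k^'k"
  assumes "open S" "u \<in> S" and inv: "\<And>v. v \<in> S \<Longrightarrow> invertible (M v)"
    and M: "\<And>i j. (\<lambda>v. M v $ i $ j) differentiable at u"
  shows "(\<lambda>v. matrix_inv (M v) $ i $ j) differentiable at u"
proof (rule differentiable_cong_open[OF assms(1,2)])
  show "(\<lambda>v. det (\<chi> k l. if l = i then axis j 1 $ k else M v $ k $ l) / det (M v)) differentiable at u"
  proof (intro differentiable_divide differentiable_det M)
    show "det (M u) \<noteq> 0" using inv[OF assms(2)] by (simp add: invertible_det_nz)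
    show "(\<lambda>v. (\<chi> k l. if l = i then axis j 1 $ k else M v $ k $ l) $ ia $ ja) differentiable at u" for ia ja
      using M by (cases "ja = i") auto
  qed
next
  fix v assume "v \<in> S"
  then have "M v *v (matrix_inv (M v) *v axis j 1) = axis j 1" and "det (M v) \<noteq> 0"
    using inv[of v] by (simp_all add: matrix_vector_mul_assoc matrix_inv_cancel invertible_det_nz)
  then have "matrix_inv (M v) *v axis j 1 =
      (\<chi> i. det (\<chi> k l. if l = i then axis j 1 $ k else M v $ k $ l) / det (M v))"
    using cramer by blast
  moreover have "matrix_inv (M v) $ i $ j = (matrix_inv (M v) *v axis j 1) $ i"
    by (simp add: matrix_vector_mult_def axis_def if_distrib cong: if_cong)
  ultimately show "det (\<chi> k l. if l = i then axis j 1 $ k else M v $ k $ l) / det (M v) = matrix_inv (M v) $ i $ j"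
    by simp
qed


section \<open>Symmetry of second derivatives\<close>

lemma DERIV_coordinate_line:
  fixes f :: "real^'n \<Rightarrow> real"
  assumes "f differentiable at (p + s *\<^sub>R axis a 1)"
  shows "((\<lambda>t. f (p + t *\<^sub>R axis a 1)) has_real_derivative pd a f (p + s *\<^sub>R axis a 1)) (at s)"
proof -
  have "((\<lambda>t. p + t *\<^sub>R axis a 1) has_derivative (\<lambda>t. t *\<^sub>R axis a 1)) (at s)"
    by (auto intro!: derivative_eq_intros)
  from diff_chain_at[OF this has_derivative_frechet[OF assms]]
  have "((\<lambda>t. f (p + t *\<^sub>R axis a 1)) has_derivative
      (\<lambda>t. frechet_derivative f (at (p + s *\<^sub>R axis a 1)) (t *\<^sub>R axis a 1))) (at s)"
    by (simp add: o_def)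
  then show ?thesis
    using linear_frechet_derivative[OF assms]
    by (simp add: has_field_derivative_def pd_def linear_cmul mult_commute_abs)
qed

text \<open>
  The mean value theorem, first along \<open>a\<close> and then along \<open>b\<close>. The left-hand side is symmetric in
  \<open>a\<close> and \<open>b\<close>, so it also expresses the other mixed derivative, at some other nearby point; this is
  what gives the symmetry of second derivatives.
\<close>

lemma second_difference:
  fixes f :: "real^'n \<Rightarrow> real"
  assumes "0 < r"
    and f: "\<And>z. z \<in> ball u r \<Longrightarrow> f differentiable at z"
    and af: "\<And>z. z \<in> ball u r \<Longrightarrow> pd a f differentiable at z"
  defines "h \<equiv> r / 3"
  shows "\<exists>z\<in>ball u r. f (u + h *\<^sub>R axis b 1 + h *\<^sub>R axis a 1) - f (u + h *\<^sub>R axis a 1)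
           - f (u + h *\<^sub>R axis b 1) + f u = h * h * pd b (pd a f) z"
proof -
  have "0 < h" using \<open>0 < r\<close> by (simp add: h_def)
  \<comment> \<open>Two steps of length at most \<open>r / 3\<close> stay inside the ball.\<close>
  have in_ball: "u + t *\<^sub>R axis b 1 + s *\<^sub>R axis a 1 \<in> ball u r"
    if "0 \<le> s" "s \<le> h" "0 \<le> t" "t \<le> h" for s t
  proof -
    have "norm (t *\<^sub>R axis b 1 + s *\<^sub>R (axis a 1 :: real^'n)) \<le> t + s"
      using that norm_triangle_ineq[of "t *\<^sub>R axis b 1" "s *\<^sub>R (axis a 1 :: real^'n)"] by simp
    also have "\<dots> < r" using that \<open>0 < r\<close> by (simp add: h_def)
    finally show ?thesis by (simp add: dist_norm norm_minus_commute add.commute)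
  qed
  define g where "g s = f (u + h *\<^sub>R axis b 1 + s *\<^sub>R axis a 1) - f (u + s *\<^sub>R axis a 1)" for s
  have "\<exists>s>0. s < h \<and> g h - g 0 = (h - 0) *
     (pd a f (u + h *\<^sub>R axis b 1 + s *\<^sub>R axis a 1) - pd a f (u + s *\<^sub>R axis a 1))"
    unfolding g_def using \<open>0 < h\<close> in_ball in_ball[where t=0]
    by (intro MVT2 DERIV_diff DERIV_coordinate_line f) auto
  then obtain s where s: "0 < s" "s < h" and gs: "g h - g 0 = h *
     (pd a f (u + h *\<^sub>R axis b 1 + s *\<^sub>R axis a 1) - pd a f (u + s *\<^sub>R axis a 1))" by auto
  have *: "u + t *\<^sub>R axis b 1 + s *\<^sub>R axis a 1 = (u + s *\<^sub>R axis a 1) + t *\<^sub>R axis b 1" for t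
    by simp
  have in_ball': "(u + s *\<^sub>R axis a 1) + t *\<^sub>R axis b 1 \<in> ball u r" if "0 \<le> t" "t \<le> h" for t
    using in_ball[of s t] s that unfolding * by simp
  have "\<exists>t>0. t < h \<and> pd a f ((u + s *\<^sub>R axis a 1) + h *\<^sub>R axis b 1)
      - pd a f ((u + s *\<^sub>R axis a 1) + 0 *\<^sub>R axis b 1)
      = (h - 0) * pd b (pd a f) ((u + s *\<^sub>R axis a 1) + t *\<^sub>R axis b 1)"
    using \<open>0 < h\<close> in_ball'
    by (intro MVT2 DERIV_coordinate_line af) auto
  then obtain t where t: "0 < t" "t < h" and gt: "pd a f (u + h *\<^sub>R axis b 1 + s *\<^sub>R axis a 1)
      - pd a f (u + s *\<^sub>R axis a 1) = h * pd b (pd a f) (u + t *\<^sub>R axis b 1 + s *\<^sub>R axis a 1)"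
    unfolding * by auto
  show ?thesis
    using gs in_ball[of s t] s t unfolding gt g_def by (intro bexI) (auto simp: algebra_simps)
qed

lemma pd_commute_real:
  fixes f :: "real^'n \<Rightarrow> real"
  assumes "open S" "u \<in> S"
    and f: "\<And>z. z \<in> S \<Longrightarrow> f differentiable at z"
    and af: "\<And>z. z \<in> S \<Longrightarrow> pd a f differentiable at z"
    and bf: "\<And>z. z \<in> S \<Longrightarrow> pd b f differentiable at z"
    and cont: "isCont (pd a (pd b f)) u" "isCont (pd b (pd a f)) u"
  shows "pd a (pd b f) u = pd b (pd a f) u"
proof (rule ccontr)
  assume neq: "pd a (pd b f) u \<noteq> pd b (pd a f) u"
  define \<epsilon> where "\<epsilon> = dist (pd a (pd b f) u) (pd b (pd a f) u) / 2"
  have "0 < \<epsilon>" using neq by (simp add: \<epsilon>_def)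
  obtain r1 where r1: "r1 > 0" "\<And>z. dist z u < r1 \<Longrightarrow> dist (pd a (pd b f) z) (pd a (pd b f) u) < \<epsilon>"
    using cont(1) \<open>0 < \<epsilon>\<close> unfolding continuous_at_eps_delta by metis
  obtain r2 where r2: "r2 > 0" "\<And>z. dist z u < r2 \<Longrightarrow> dist (pd b (pd a f) z) (pd b (pd a f) u) < \<epsilon>"
    using cont(2) \<open>0 < \<epsilon>\<close> unfolding continuous_at_eps_delta by metis
  obtain r3 where r3: "r3 > 0" "ball u r3 \<subseteq> S"
    using assms(1,2) open_contains_ball by blast
  define r where "r = min r1 (min r2 r3)"
  have r: "0 < r" "\<And>z. z \<in> ball u r \<Longrightarrow> z \<in> S"
    using r1(1) r2(1) r3 by (auto simp: r_def)
  obtain z where z: "z \<in> ball u r" "f (u + (r/3) *\<^sub>R axis b 1 + (r/3) *\<^sub>R axis a 1)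
      - f (u + (r/3) *\<^sub>R axis a 1) - f (u + (r/3) *\<^sub>R axis b 1) + f u = r/3 * (r/3) * pd b (pd a f) z"
    using second_difference[of r u f a b] r f af by blast
  obtain w where w: "w \<in> ball u r" "f (u + (r/3) *\<^sub>R axis a 1 + (r/3) *\<^sub>R axis b 1)
      - f (u + (r/3) *\<^sub>R axis b 1) - f (u + (r/3) *\<^sub>R axis a 1) + f u = r/3 * (r/3) * pd a (pd b f) w"
    using second_difference[of r u f b a] r f bf by blast
  have "r/3 * (r/3) * pd b (pd a f) z = r/3 * (r/3) * pd a (pd b f) w"
    unfolding z(2)[symmetric] w(2)[symmetric] by (simp add: algebra_simps)
  then have "pd b (pd a f) z = pd a (pd b f) w" using r(1) by simp
  moreover have "dist (pd b (pd a f) z) (pd b (pd a f) u) < \<epsilon>"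
    using r2(2)[of z] z(1) by (simp add: r_def dist_commute)
  moreover have "dist (pd a (pd b f) w) (pd a (pd b f) u) < \<epsilon>"
    using r1(2)[of w] w(1) by (simp add: r_def dist_commute)
  ultimately show False
    using dist_triangle2[of "pd a (pd b f) u" "pd b (pd a f) u" "pd a (pd b f) w"]
    by (simp add: \<epsilon>_def dist_commute)
qed

lemma Ck_on_subset: "Ck_on k S f \<Longrightarrow> T \<subseteq> S \<Longrightarrow> Ck_on k T f"
  by (induction k arbitrary: f) (auto intro: continuous_on_subset)

lemma smooth_on_subset: "smooth_on S f \<Longrightarrow> T \<subseteq> S \<Longrightarrow> smooth_on T f"
  by (auto simp: smooth_on_def intro: Ck_on_subset)

lemma smooth_on_imp_differentiable: "smooth_on S f \<Longrightarrow> z \<in> S \<Longrightarrow> f differentiable at z"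
  using Ck_on.simps(2)[of 0 S f] by (simp add: smooth_on_def del: Ck_on.simps)

lemma smooth_on_pd: "smooth_on S f \<Longrightarrow> smooth_on S (pd a f)"
  unfolding smooth_on_def pd_def by (metis Ck_on.simps(2))

text \<open>
  The mean value theorem needs real values, so the argument is applied to each component.
\<close>

lemma pd_commute:
  fixes f :: "real^'n \<Rightarrow> real^'m"
  assumes "open S" "u \<in> S" and f: "smooth_on S f"
  shows "pd a (pd b f) u = pd b (pd a f) u"
proof (rule vec_eq_iff[THEN iffD2], intro allI)
  fix i
  note diff = f[THEN smooth_on_imp_differentiable] smooth_on_pd[OF f, THEN smooth_on_imp_differentiable]
    smooth_on_pd[OF smooth_on_pd[OF f], THEN smooth_on_imp_differentiable]
  let ?f = "\<lambda>v. f v $ i"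
  have 1: "pd c ?f z = pd c f z $ i" if "z \<in> S" for c z
    using pd_component[OF diff(1)] that by blast
  have 2: "pd c ?f differentiable at z" if "z \<in> S" for c z
    by (rule differentiable_cong_open[OF \<open>open S\<close> that 1[symmetric]])
      (use that in \<open>auto intro: diff differentiable_component\<close>)
  have 3: "pd c (pd e ?f) z = pd c (pd e f) z $ i" if "z \<in> S" for c e z
  proof -
    have "pd c (pd e ?f) z = pd c (\<lambda>v. pd e f v $ i) z"
      using that by (intro pd_cong_open[OF \<open>open S\<close>] 1 2)
    then show ?thesis using pd_component[OF diff(2)[OF that]] by simp
  qed
  have 4: "isCont (pd c (pd e ?f)) u" for c e
  proof -
    have "(\<lambda>z. pd c (pd e f) z $ i) differentiable at u"
      using assms by (intro differentiable_component diff)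
    then have "pd c (pd e ?f) differentiable at u"
      by (rule differentiable_cong_open[OF assms(1,2) 3[symmetric], rotated])
    then show ?thesis by (rule differentiable_imp_continuous_within)
  qed
  have "pd a (pd b ?f) u = pd b (pd a ?f) u"
    using assms(1,2) diff 2 4 by (intro pd_commute_real[of S]) (auto intro: differentiable_component)
  then show "pd a (pd b f) u $ i = pd b (pd a f) u $ i"
    using 3 assms(2) by simp
qed


section \<open>The Levi-Civita symbol\<close>

abbreviation all_indices :: "'n::{finite, linorder} list" where
  "all_indices \<equiv> sorted_list_of_set UNIV"

text \<open>
  Multi-indices of full length are the value tables of the self-maps of the index type. This
  turns sums over multi-indices into the sums over permutations that define a determinant.
\<close>

lemma bij_betw_map_all_indices:
  "bij_betw (\<lambda>\<sigma> :: 'n \<Rightarrow> 'n. map \<sigma> all_indices) UNIV (multi_indices CARD('n::{finite, linorder}))"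
proof (rule bij_betwI')
  fix \<sigma> \<tau> :: "'n \<Rightarrow> 'n"
  show "(map \<sigma> all_indices = map \<tau> all_indices) = (\<sigma> = \<tau>)"
    by (auto simp: map_eq_conv)
  show "map \<sigma> all_indices \<in> multi_indices CARD('n)"
    by (simp add: multi_indices_def)
next
  fix as :: "'n list" assume as: "as \<in> multi_indices CARD('n)"
  define \<sigma> :: "'n \<Rightarrow> 'n" where "\<sigma> a = as ! inv_into {..<CARD('n)} ((!) all_indices) a" for a
  have "inj_on ((!) (all_indices :: 'n list)) {..<CARD('n)}"
    by (intro inj_on_nth) auto
  then have "map \<sigma> (all_indices :: 'n list) = as"
    using as by (intro nth_equalityI) (auto simp: \<sigma>_def multi_indices_def inv_into_f_f)
  then show "\<exists>\<sigma>\<in>(UNIV :: ('n \<Rightarrow> 'n) set). as = map \<sigma> all_indices" by blast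
qed

lemma multi_index_eq_map:
  fixes as :: "'n::{finite, linorder} list"
  assumes "length as = CARD('n)"
  obtains \<sigma> :: "'n \<Rightarrow> 'n" where "as = map \<sigma> (all_indices :: 'n list)"
proof -
  have "as \<in> multi_indices CARD('n)" using assms by (simp add: multi_indices_def)
  then have "as \<in> range (\<lambda>\<sigma>. map \<sigma> (all_indices :: 'n list))"
    using bij_betw_map_all_indices[where 'n='n] by (simp add: bij_betw_def)
  then show ?thesis using that by blast
qed

lemma permutes_UNIV_iff_inj: "\<sigma> permutes UNIV \<longleftrightarrow> inj \<sigma>" for \<sigma> :: "'k::finite \<Rightarrow> 'k"
proof
  assume "inj \<sigma>"
  then have "bij \<sigma>" using finite_UNIV_inj_surj[of \<sigma>] by (simp add: bij_def)
  then show "\<sigma> permutes UNIV" by (intro bij_imp_permutes) auto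
qed (rule permutes_inj)

lemma levi_civita_map:
  fixes \<sigma> :: "'n::{finite, linorder} \<Rightarrow> 'n"
  shows "levi_civita (map \<sigma> all_indices) = (if \<sigma> permutes UNIV then of_int (sign \<sigma>) else 0)"
proof -
  have "(THE \<tau>. map \<tau> all_indices = map \<sigma> all_indices) = \<sigma>"
    using bij_betw_map_all_indices[where 'n='n] by (auto simp: bij_betw_def inj_on_def)
  moreover have "distinct (map \<sigma> all_indices) \<longleftrightarrow> \<sigma> permutes UNIV"
    by (simp add: distinct_map permutes_UNIV_iff_inj)
  ultimately show ?thesis
    by (simp add: levi_civita_def)
qed

lemma levi_civita_eq_0:
  "\<not> distinct as \<Longrightarrow> levi_civita as = 0" by (simp add: levi_civita_def)

lemma levi_civita_squared:
  fixes as :: "'n::{finite, linorder} list"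
  assumes "length as = CARD('n)"
  shows "levi_civita as * levi_civita as = (if distinct as then 1 else 0)"
proof -
  obtain \<sigma> :: "'n \<Rightarrow> 'n" where \<sigma>: "as = map \<sigma> all_indices"
    using multi_index_eq_map[OF assms] .
  have "of_int (sign \<sigma>) * of_int (sign \<sigma>) = (1::real)"
    by (cases rule: sign_cases[of \<sigma>]) auto
  then have "levi_civita as * levi_civita as = (if \<sigma> permutes UNIV then 1 else 0)"
    by (simp add: \<sigma> levi_civita_map)
  moreover have "\<not> distinct as" if "\<not> \<sigma> permutes UNIV"
    using that by (simp add: \<sigma> distinct_map permutes_UNIV_iff_inj)
  moreover have "distinct as" if "\<sigma> permutes UNIV"
    using that by (auto simp: \<sigma> distinct_map permutes_inj)
  ultimately show ?thesis by auto
qed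

lemma levi_civita_swap:
  fixes a b :: "'n::{finite, linorder}"
  shows "levi_civita (b # a # as) = - levi_civita (a # b # as)"
proof (cases "length (a # b # as) = CARD('n) \<and> distinct (a # b # as)")
  case True
  then obtain \<sigma> :: "'n \<Rightarrow> 'n" where \<sigma>: "a # b # as = map \<sigma> all_indices"
    using multi_index_eq_map by blast
  have "distinct (map \<sigma> (all_indices :: 'n list))" using True \<sigma> by metis
  then have inj: "inj \<sigma>" by (simp add: distinct_map)
  then have perm: "\<sigma> permutes UNIV"
    by (simp add: permutes_UNIV_iff_inj)
  have "b # a # as = map (Transposition.transpose a b) (a # b # as)"
    using True by (auto intro!: map_idI[symmetric] simp: Transposition.transpose_def)
  also have "\<dots> = map (Transposition.transpose a b \<circ> \<sigma>) all_indices" by (simp add: \<sigma>)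
  finally have "levi_civita (b # a # as) = of_int (sign (Transposition.transpose a b \<circ> \<sigma>))"
    using perm by (simp add: levi_civita_map permutes_compose permutes_swap_id)
  also have "sign (Transposition.transpose a b \<circ> \<sigma>) = - sign \<sigma>"
    using perm True by (subst sign_compose)
      (auto simp: sign_swap_id permutation_swap_id intro: permutes_imp_permutation[of UNIV])
  finally show ?thesis
    using perm by (simp add: \<sigma> levi_civita_map)
next
  case False
  then show ?thesis by (auto simp: levi_civita_def)
qed

lemma finite_multi_indices [simp]: "finite (multi_indices r :: 'k::finite list set)"
  using finite_lists_length_eq[of "UNIV :: 'k set" r] by (simp add: multi_indices_def)

lemma sum_multi_indices_Suc:
  "(\<Sum>as\<in>multi_indices (Suc r). f as) = (\<Sum>a::'k::finite\<in>UNIV. \<Sum>as\<in>multi_indices r. f (a # as))"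
proof -
  have "(\<Sum>a\<in>UNIV. \<Sum>as\<in>multi_indices r. f (a # as))
      = (\<Sum>p\<in>UNIV \<times> multi_indices r. f (fst p # snd p))"
    by (simp add: sum.cartesian_product case_prod_beta)
  also have "\<dots> = (\<Sum>as\<in>multi_indices (Suc r). f as)"
    by (intro sum.reindex_bij_witness[of _ "\<lambda>as. (hd as, tl as)" "\<lambda>p. fst p # snd p"])
      (auto simp: multi_indices_def length_Suc_conv)
  finally show ?thesis ..
qed

lemma prod_lessThan_Cons:
  "(\<Prod>r<Suc n. P ((a # as) ! r) ((b # bs) ! r)) = P a b * (\<Prod>r<n. P (as ! r) (bs ! r))"
  for P :: "_ \<Rightarrow> _ \<Rightarrow> 'a::comm_monoid_mult"
  unfolding prod.lessThan_Suc_shift by simp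

text \<open>
  The sum is the determinant of the matrix whose rows are those of \<open>M\<close> in the order prescribed by
  \<open>as\<close>: rearranging rows costs the sign, and a repeated row makes the determinant vanish.
\<close>

lemma sum_levi_civita_prod:
  fixes M :: "((real, 'n::{finite, linorder}) vec, 'n) vec"
  assumes "length as = CARD('n)"
  shows "(\<Sum>bs\<in>multi_indices CARD('n). levi_civita bs * (\<Prod>r<CARD('n). M $ (as ! r) $ (bs ! r)))
    = levi_civita as * det M"
proof -
  obtain \<sigma> :: "'n \<Rightarrow> 'n" where \<sigma>: "as = map \<sigma> all_indices"
    using multi_index_eq_map[OF assms] .
  have prod: "(\<Prod>r<CARD('n). M $ (as ! r) $ (map \<tau> all_indices ! r)) = (\<Prod>i\<in>UNIV. M $ \<sigma> i $ \<tau> i)"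
    for \<tau> :: "'n \<Rightarrow> 'n"
  proof -
    have "bij_betw ((!) (all_indices :: 'n list)) {..<CARD('n)} UNIV"
      by (rule bij_betw_nth) auto
    from prod.reindex_bij_betw[OF this, of "\<lambda>i. M $ \<sigma> i $ \<tau> i"] show ?thesis
      by (simp add: \<sigma>)
  qed
  have "(\<Sum>bs\<in>multi_indices CARD('n). levi_civita bs * (\<Prod>r<CARD('n). M $ (as ! r) $ (bs ! r)))
      = (\<Sum>\<tau>\<in>UNIV. levi_civita (map \<tau> all_indices) * (\<Prod>i\<in>UNIV. M $ \<sigma> i $ \<tau> i))"
    by (subst sum.reindex_bij_betw[OF bij_betw_map_all_indices, symmetric]) (simp only: prod)
  also have "\<dots> = (\<Sum>\<tau>\<in>{\<tau>. \<tau> permutes UNIV}. of_int (sign \<tau>) * (\<Prod>i\<in>UNIV. M $ \<sigma> i $ \<tau> i))"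
    by (intro sum.mono_neutral_cong_right) (auto simp: levi_civita_map)
  also have "\<dots> = det (\<chi> i. M $ \<sigma> i)" by (simp add: det_def)
  also have "\<dots> = levi_civita as * det M"
  proof (cases "\<sigma> permutes UNIV")
    case True
    then show ?thesis by (simp add: det_permute_rows \<sigma> levi_civita_map)
  next
    case False
    then have "\<not> inj \<sigma>"
      by (simp add: permutes_UNIV_iff_inj)
    then obtain i j where "i \<noteq> j" "\<sigma> i = \<sigma> j" by (auto simp: inj_def)
    then have "det (\<chi> i. M $ \<sigma> i) = 0"
      by (intro det_identical_rows[of i j]) (auto simp: row_def)
    then show ?thesis using False by (simp add: \<sigma> levi_civita_map)
  qed
  finally show ?thesis .
qed

text \<open>
  If \<open>a \<noteq> c\<close>, a tail that completes both \<open>a\<close> and \<open>c\<close> to a permutation would have to avoid both of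
  them and is one index too long. If \<open>a = c\<close>, each arrangement of the other indices contributes \<open>1\<close>.
\<close>

lemma sum_levi_civita_contract:
  fixes a c :: "'n::{finite, linorder}"
  shows "(\<Sum>as\<in>multi_indices (CARD('n) - 1). levi_civita (a # as) * levi_civita (c # as))
    = (if a = c then fact (CARD('n) - 1) else 0)"
proof (cases "a = c")
  case True
  have len: "length (a # as) = CARD('n)" if "as \<in> multi_indices (CARD('n) - 1)" for as
    using that by (simp add: multi_indices_def)
  let ?D = "{as. length as = CARD('n) - 1 \<and> distinct as \<and> set as \<subseteq> UNIV - {a}}"
  have "(\<Sum>as\<in>multi_indices (CARD('n) - 1). levi_civita (a # as) * levi_civita (a # as))
      = (\<Sum>as\<in>multi_indices (CARD('n) - 1). if as \<in> ?D then 1 else 0)"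
    by (intro sum.cong refl) (auto simp: levi_civita_squared len multi_indices_def simp del: length_Cons)
  also have "\<dots> = card (multi_indices (CARD('n) - 1) \<inter> ?D)"
    by (simp add: sum.If_cases)
  also have "multi_indices (CARD('n) - 1) \<inter> ?D = ?D" by (auto simp: multi_indices_def)
  also have "card ?D = fact (CARD('n) - 1)"
    by (subst card_lists_distinct_length_eq) (auto simp: card_Diff_singleton fact_prod)
  finally show ?thesis using True by simp
next
  case False
  have "levi_civita (a # as) * levi_civita (c # as) = 0" if "as \<in> multi_indices (CARD('n) - 1)" for as
  proof (cases "distinct (a # as) \<and> distinct (c # as)")
    case True
    have "length as = CARD('n) - 1" using that by (simp add: multi_indices_def)
    then have "card (set (a # c # as)) = Suc CARD('n)"
      using True False distinct_card[of "a # c # as"] by simp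
    then show ?thesis using card_mono[of UNIV "set (a # c # as)"] by (simp del: set_simps)
  qed (auto simp: levi_civita_eq_0)
  then have "(\<Sum>as\<in>multi_indices (CARD('n) - 1). levi_civita (a # as) * levi_civita (c # as)) = 0"
    by (intro sum.neutral) blast
  then show ?thesis using False by simp
qed


section \<open>Vector and matrix fields\<close>

lemma differentiable_vecI:
  fixes f :: "'a::real_normed_vector \<Rightarrow> 'b::euclidean_space^'k"
  assumes "\<And>i. (\<lambda>v. f v $ i) differentiable at u"
  shows "f differentiable at u"
proof (subst differentiable_componentwise_within, intro ballI)
  fix b :: "'b^'k" assume "b \<in> Basis"
  then obtain i c where "b = axis i c" by (auto simp: Basis_vec_def)
  then show "(\<lambda>v. f v \<bullet> b) differentiable at u"
    using assms[of i] by (simp add: inner_axis)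
qed

lemma differentiable_entry:
  assumes "M differentiable at u"
  shows "(\<lambda>v. M v $ i $ j) differentiable at u"
  using assms by (intro differentiable_component)

lemma pd_entry:
  fixes M :: "real^'n \<Rightarrow> real^'k^'m"
  assumes "M differentiable at u"
  shows "pd a (\<lambda>v. M v $ i $ j) u = pd a M u $ i $ j"
  using assms by (simp add: pd_component differentiable_component)

lemma differentiable_matrix_vector_mult:
  fixes M :: "real^'n \<Rightarrow> real^'k^'m"
  assumes "M differentiable at u" "V differentiable at u"
  shows "(\<lambda>v. M v *v V v) differentiable at u"
  by (intro differentiable_vecI)
    (simp add: matrix_vector_mult_def differentiable_sum differentiable_mult differentiable_entry
      differentiable_component assms)

lemma pd_matrix_vector_mult:
  fixes M :: "real^'n \<Rightarrow> real^'k^'m"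
  assumes "M differentiable at u" "V differentiable at u"
  shows "pd a (\<lambda>v. M v *v V v) u = pd a M u *v V u + M u *v pd a V u"
proof (rule vec_eq_iff[THEN iffD2], intro allI)
  fix i
  have "pd a (\<lambda>v. M v *v V v) u $ i = pd a (\<lambda>v. (M v *v V v) $ i) u"
    using assms by (simp add: pd_component differentiable_matrix_vector_mult)
  also have "\<dots> = (\<Sum>j\<in>UNIV. pd a M u $ i $ j * V u $ j + M u $ i $ j * pd a V u $ j)"
    using assms by (simp add: matrix_vector_mult_def pd_sum pd_mult differentiable_mult
        differentiable_entry differentiable_component pd_entry pd_component)
  finally show "pd a (\<lambda>v. M v *v V v) u $ i = (pd a M u *v V u + M u *v pd a V u) $ i"
    by (simp add: matrix_vector_mult_def sum.distrib)
qed

lemma ip_eq_inner: "ip g v w = v \<bullet> (g *v w)"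
  by (simp add: ip_def inner_vec_def matrix_vector_mult_def sum_distrib_left ac_simps)

lemma ip_bilinear:
  "ip g (v + v') w = ip g v w + ip g v' w" "ip g v (w + w') = ip g v w + ip g v w'"
  "ip g (v - v') w = ip g v w - ip g v' w" "ip g v (w - w') = ip g v w - ip g v w'"
  "ip g (- v) w = - ip g v w" "ip g v (- w) = - ip g v w"
  "ip g (c *\<^sub>R v) w = c * ip g v w" "ip g v (c *\<^sub>R w) = c * ip g v w"
  by (simp_all add: ip_eq_inner inner_simps matrix_vector_right_distrib matrix_vector_mult_diff_distrib
      vec.neg matrix_vector_mult_scaleR)

lemma ip_sum:
  "ip g (\<Sum>i\<in>I. f i) w = (\<Sum>i\<in>I. ip g (f i) w)" "ip g w (\<Sum>i\<in>I. f i) = (\<Sum>i\<in>I. ip g w (f i))"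
  by (simp_all add: ip_eq_inner inner_sum_left inner_sum_right vec.sum)

lemma ip_commute:
  assumes "transpose g = g"
  shows "ip g v w = ip g w v"
  by (metis assms dot_lmul_matrix inner_commute ip_eq_inner transpose_matrix_vector)

lemma differentiable_ip:
  fixes M :: "real^'n \<Rightarrow> real^'m^'m"
  assumes "M differentiable at u" "V differentiable at u" "W differentiable at u"
  shows "(\<lambda>v. ip (M v) (V v) (W v)) differentiable at u"
  using assms unfolding ip_eq_inner by (intro differentiable_inner differentiable_matrix_vector_mult)

lemma pd_ip:
  fixes M :: "real^'n \<Rightarrow> real^'m^'m"
  assumes "M differentiable at u" "V differentiable at u" "W differentiable at u"
  shows "pd a (\<lambda>v. ip (M v) (V v) (W v)) u =
    ip (pd a M u) (V u) (W u) + ip (M u) (pd a V u) (W u) + ip (M u) (V u) (pd a W u)"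
proof -
  have "((\<lambda>v. V v \<bullet> (M v *v W v)) has_derivative
      (\<lambda>h. V u \<bullet> frechet_derivative (\<lambda>v. M v *v W v) (at u) h
         + frechet_derivative V (at u) h \<bullet> (M u *v W u))) (at u)"
    using assms by (intro has_derivative_inner has_derivative_frechet differentiable_matrix_vector_mult)
  from pd_eqI[OF this, of a]
  have "pd a (\<lambda>v. V v \<bullet> (M v *v W v)) u
      = V u \<bullet> pd a (\<lambda>v. M v *v W v) u + pd a V u \<bullet> (M u *v W u)"
    by (simp add: pd_def)
  then show ?thesis
    using assms by (simp add: ip_eq_inner pd_matrix_vector_mult inner_simps)
qed

lemma invertible_if_positive:
  fixes g :: "real^'k^'k"
  assumes "\<And>w. w \<noteq> 0 \<Longrightarrow> w \<bullet> (g *v w) > 0"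
  shows "invertible g"
  unfolding invertible_left_inverse matrix_left_invertible_ker
  using assms by (metis inner_zero_right less_irrefl)

text \<open>
  The segment from the identity to \<open>g\<close> consists of positive definite, hence invertible, matrices, so
  the determinant cannot change sign along it.
\<close>

lemma det_pos_if_positive:
  fixes g :: "real^'k^'k"
  assumes pos: "\<And>w. w \<noteq> 0 \<Longrightarrow> w \<bullet> (g *v w) > 0"
  shows "det g > 0"
proof (rule ccontr)
  assume "\<not> det g > 0"
  define h where "h t = t *\<^sub>R g + (1 - t) *\<^sub>R mat 1" for t :: real
  have "continuous_on {0..1} (\<lambda>t. det (h t))"
    unfolding h_def det_def by (intro continuous_intros)
  moreover have "det (h 0) = 1" "det (h 1) \<le> 0"
    using \<open>\<not> det g > 0\<close> by (simp_all add: h_def)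
  ultimately obtain t where t: "0 \<le> t" "t \<le> 1" "det (h t) = 0"
    using IVT2'[of "\<lambda>t. det (h t)" 1 0 0] by auto
  have "w \<bullet> (h t *v w) > 0" if "w \<noteq> 0" for w
  proof -
    have "w \<bullet> (h t *v w) = t * (w \<bullet> (g *v w)) + (1 - t) * (w \<bullet> w)"
      by (simp add: h_def matrix_vector_mult_add_rdistrib scaleR_matrix_vector_assoc[symmetric] inner_simps)
    moreover have "\<dots> > 0"
      using t pos[OF that] that
      by (cases "t = 0") (auto intro!: add_pos_nonneg simp: power2_norm_eq_inner[symmetric])
    ultimately show ?thesis by simp
  qed
  then show False using invertible_if_positive[of "h t"] t(3) by (simp add: invertible_det_nz)
qed


section \<open>Christoffel symbols\<close>

lemma axis_sum: "(\<Sum>a\<in>UNIV. axis b (1::real) $ a * F a) = F b"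
  by (simp add: axis_def if_distrib[of "\<lambda>c. c * _"] cong: if_cong)

text \<open>
  Lowering the upper index of $\Gamma^c_{ab}$ removes the inverse metric. Only this form of the
  Christoffel symbols is used for their relation to the metric.
\<close>

lemma christoffel_lower:
  fixes g :: "real^'k \<Rightarrow> real^'k^'k"
  assumes "invertible (g z)"
  shows "(\<Sum>c\<in>UNIV. g z $ d $ c * christoffel g c a b z)
    = (pd a (\<lambda>y. g y $ d $ b) z + pd b (\<lambda>y. g y $ d $ a) z - pd d (\<lambda>y. g y $ a $ b) z) / 2"
proof -
  define K where "K = (\<chi> l. (pd a (\<lambda>y. g y $ l $ b) z + pd b (\<lambda>y. g y $ l $ a) z - pd l (\<lambda>y. g y $ a $ b) z) / 2)"
  have "(\<chi> c. christoffel g c a b z) = matrix_inv (g z) *v K"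
    by (simp add: christoffel_def matrix_vector_mult_def K_def sum_distrib_left vec_eq_iff)
  then have "g z *v (\<chi> c. christoffel g c a b z) = K"
    by (simp add: matrix_vector_mul_assoc matrix_inv_cancel assms)
  then show ?thesis
    by (simp add: vec_eq_iff matrix_vector_mult_def K_def)
qed

lemma christoffel_commute:
  fixes g :: "real^'k \<Rightarrow> real^'k^'k"
  assumes "open S" "z \<in> S" "\<And>y. y \<in> S \<Longrightarrow> transpose (g y) = g y" "g differentiable at z"
  shows "christoffel g c a b z = christoffel g c b a z"
proof -
  have "pd l (\<lambda>y. g y $ a $ b) z = pd l (\<lambda>y. g y $ b $ a) z" for l
    using assms by (intro pd_cong_open[of S]) (auto simp: vec_eq_iff transpose_def differentiable_entry)
  then show ?thesis by (simp add: christoffel_def add.commute)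
qed


section \<open>An isometrically immersed coordinate patch\<close>

text \<open>
  Everything happens inside one chart of each manifold: \<open>U\<close> is the coordinate range of the chart of
  \<open>M\<close>, and \<open>V\<close> is the set of coordinates of \<open>\<Sigma>\<close> on which the normal frame is given.
\<close>

locale submanifold_patch =
  fixes G :: "real^'m \<Rightarrow> real^'m^'m" and U :: "(real^'m) set"
    and x :: "real^'n \<Rightarrow> real^'m" and V :: "(real^'n) set"
    and N :: "'p::finite \<Rightarrow> real^'n \<Rightarrow> real^'m"
  assumes open_U: "open U" and open_V: "open V" and x_in_U: "v \<in> V \<Longrightarrow> x v \<in> U"
    and smooth_G: "smooth_on U G"
    and G_sym: "y \<in> U \<Longrightarrow> transpose (G y) = G y"
    and G_pos: "y \<in> U \<Longrightarrow> w \<noteq> 0 \<Longrightarrow> w \<bullet> (G y *v w) > 0"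
    and smooth_x: "smooth_on V x"
    and immersion: "v \<in> V \<Longrightarrow> inj (frechet_derivative x (at v))"
    and normals: "orthonormal_normal_fields G x N V"
    and codim: "CARD('m) = CARD('n) + CARD('p)"
begin

abbreviation metric :: "real^'n \<Rightarrow> real^'m \<Rightarrow> real^'m \<Rightarrow> real" where
  "metric u \<equiv> ip (G (x u))"

abbreviation e :: "'n \<Rightarrow> real^'n \<Rightarrow> real^'m" where
  "e a \<equiv> pd a x"

abbreviation g :: "real^'n \<Rightarrow> real^'n^'n" where
  "g \<equiv> induced_metric G x"

abbreviation cov :: "'n \<Rightarrow> (real^'n \<Rightarrow> real^'m) \<Rightarrow> real^'n \<Rightarrow> real^'m" where
  "cov a \<equiv> covariant_derivative_along G x (axis a 1)"

text \<open>
  The matrix of the connection pulled back along \<open>x\<close>: covariant differentiation in the direction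
  $e_a$ is $\partial_a$ plus this matrix (\<open>cov_eq\<close>).
\<close>

definition conn :: "'n \<Rightarrow> real^'n \<Rightarrow> real^'m^'m" where
  "conn a u = (\<chi> i k. \<Sum>j\<in>UNIV. christoffel G i j k (x u) * e a u $ j)"

lemma cov_eq: "cov a W u = pd a W u + conn a u *v W u"
proof (rule vec_eq_iff[THEN iffD2], intro allI)
  fix i
  have "(\<Sum>j\<in>UNIV. \<Sum>k\<in>UNIV. christoffel G i j k (x u) * e a u $ j * W u $ k) = (conn a u *v W u) $ i"
    unfolding conn_def matrix_vector_mult_def by (simp add: sum_distrib_right) (rule sum.swap)
  then show "cov a W u $ i = (pd a W u + conn a u *v W u) $ i"
    by (simp add: covariant_derivative_along_def axis_sum)
qed

lemma smooth_N: "smooth_on V (N A)"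
  using normals by (simp add: orthonormal_normal_fields_def)

lemma smooth_e: "smooth_on V (e a)"
  by (rule smooth_on_pd[OF smooth_x])

lemmas differentiable_x = smooth_on_imp_differentiable[OF smooth_x]
  and differentiable_e = smooth_on_imp_differentiable[OF smooth_e]
  and differentiable_N = smooth_on_imp_differentiable[OF smooth_N]
  and differentiable_pd_N = smooth_on_imp_differentiable[OF smooth_on_pd[OF smooth_N]]
  and differentiable_G = smooth_on_imp_differentiable[OF smooth_G]
  and differentiable_pd_G = smooth_on_imp_differentiable[OF smooth_on_pd[OF smooth_G]]

lemma G_invertible: "y \<in> U \<Longrightarrow> invertible (G y)"
  using G_pos by (rule invertible_if_positive)

lemma metric_commute: "u \<in> V \<Longrightarrow> metric u v w = metric u w v"
  by (intro ip_commute G_sym x_in_U)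

lemma differentiable_G_x: "u \<in> V \<Longrightarrow> (\<lambda>v. G (x v)) differentiable at u"
  using differentiable_chain_at[OF differentiable_x differentiable_G[OF x_in_U]] by (simp add: o_def)

lemma differentiable_christoffel:
  assumes "y \<in> U"
  shows "christoffel G i j k differentiable at y"
proof -
  have "pd j (\<lambda>y. G y $ l $ k) differentiable at y" for j l k
    by (rule differentiable_cong_open[OF open_U assms, of "\<lambda>y. pd j G y $ l $ k"])
      (simp_all add: pd_entry differentiable_entry differentiable_G differentiable_pd_G assms)
  moreover have "(\<lambda>y. matrix_inv (G y) $ i $ l) differentiable at y" for l
    by (rule differentiable_matrix_inv[OF open_U assms])
      (simp_all add: G_invertible differentiable_entry differentiable_G assms)
  ultimately show ?thesis
    unfolding christoffel_def[abs_def] 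
    by (intro differentiable_mult differentiable_sum differentiable_const ballI differentiable_add differentiable_diff) auto
qed

lemma differentiable_christoffel_x: "u \<in> V \<Longrightarrow> (\<lambda>v. christoffel G i j k (x v)) differentiable at u"
  using differentiable_chain_at[OF differentiable_x differentiable_christoffel[OF x_in_U]]
  by (simp add: o_def)

lemma differentiable_conn: "u \<in> V \<Longrightarrow> conn a differentiable at u"
  by (intro differentiable_vecI)
    (simp add: conn_def differentiable_christoffel_x differentiable_e differentiable_component)

lemma differentiable_cov_N: "u \<in> V \<Longrightarrow> cov a (N A) differentiable at u"
  unfolding cov_eq[abs_def]
  by (intro differentiable_add differentiable_matrix_vector_mult differentiable_conn differentiable_N
     differentiable_pd_N)

text \<open>
  This is metric compatibility in matrix form. The chain rule reduces it to
  $\partial_k \bar g_{ij} = \bar g_{il}\bar\Gamma^l_{kj} + \bar g_{jl}\bar\Gamma^l_{ki}$, where the two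
  combinations of derivatives given by \<open>christoffel_lower\<close> add up by the symmetry of $\bar g$.
\<close>

lemma pd_metric_matrix:
  assumes "u \<in> V"
  shows "pd a (\<lambda>v. G (x v)) u = G (x u) ** conn a u + transpose (conn a u) ** G (x u)"
proof -
  have sym: "pd k (\<lambda>y. G y $ i $ j) (x u) = pd k (\<lambda>y. G y $ j $ i) (x u)" for i j k
    using G_sym by (intro pd_cong_open[OF open_U x_in_U[OF assms]])
      (auto simp: vec_eq_iff transpose_def differentiable_entry differentiable_G x_in_U assms)
  have Gs: "G (x u) $ l $ j = G (x u) $ j $ l" for j l
    using G_sym[OF x_in_U[OF assms]] by (auto simp: vec_eq_iff transpose_def)
  have compat: "pd k (\<lambda>y. G y $ i $ j) (x u) = (\<Sum>l\<in>UNIV. G (x u) $ i $ l * christoffel G l k j (x u))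
      + (\<Sum>l\<in>UNIV. G (x u) $ j $ l * christoffel G l k i (x u))" for i j k
    unfolding christoffel_lower[where g=G and z="x u", OF G_invertible[OF x_in_U[OF assms]]]
    using sym[of k i j] sym[of i j k] sym[of j i k] by (simp add: field_simps)
  have "pd a (\<lambda>v. G (x v)) u $ i $ j = (\<Sum>k\<in>UNIV. pd k (\<lambda>y. G y $ i $ j) (x u) * e a u $ k)" for i j
    using assms
    using pd_chain[OF differentiable_x differentiable_entry[OF differentiable_G[OF x_in_U]], of u a i j]
    by (simp add: pd_entry[symmetric] differentiable_G_x)
  also have "\<dots> i j = (\<Sum>l\<in>UNIV. G (x u) $ i $ l * conn a u $ l $ j) + (\<Sum>l\<in>UNIV. conn a u $ l $ i * G (x u) $ l $ j)" for i j
    unfolding compat conn_def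
    by (simp add: sum_distrib_left sum_distrib_right distrib_left distrib_right sum.distrib Gs[of j] mult_ac)
      (intro arg_cong2[where f="(+)"] sum.swap)
  finally show ?thesis
    by (simp add: vec_eq_iff matrix_matrix_mult_def transpose_def)
qed

lemma metric_compatible:
  assumes "u \<in> V" "W differentiable at u" "Z differentiable at u"
  shows "pd a (\<lambda>v. metric v (W v) (Z v)) u = metric u (cov a W u) (Z u) + metric u (W u) (cov a Z u)"
proof -
  have "w \<bullet> ((transpose C ** M) *v z) = (C *v w) \<bullet> (M *v z)" for C M :: "real^'m^'m" and w z
    by (metis dot_lmul_matrix inner_commute matrix_vector_mul_assoc transpose_matrix_vector)
  then have "ip (pd a (\<lambda>v. G (x v)) u) (W u) (Z u)
      = metric u (conn a u *v W u) (Z u) + metric u (W u) (conn a u *v Z u)"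
    by (simp add: pd_metric_matrix assms(1) ip_eq_inner matrix_vector_mult_add_rdistrib inner_simps
        matrix_vector_mul_assoc)
  then show ?thesis
    using assms by (simp add: pd_ip differentiable_G_x cov_eq ip_bilinear)
qed

lemma torsion_free:
  assumes "u \<in> V"
  shows "cov a (e b) u = cov b (e a) u"
proof -
  have sym: "christoffel G i j k (x u) = christoffel G i k j (x u)" for i j k
    using assms by (intro christoffel_commute[OF open_U x_in_U] G_sym differentiable_G x_in_U)
  have conn_e: "(conn a u *v e b u) $ i
      = (\<Sum>j\<in>UNIV. \<Sum>k\<in>UNIV. christoffel G i k j (x u) * e a u $ k * e b u $ j)" for a b i
    by (simp add: conn_def matrix_vector_mult_def sum_distrib_right)
  have "(conn a u *v e b u) $ i = (conn b u *v e a u) $ i" for i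
    unfolding conn_e by (subst sum.swap) (simp add: sym[of i] mult_ac)
  then have "conn a u *v e b u = conn b u *v e a u" by (simp add: vec_eq_iff)
  moreover have "pd a (e b) u = pd b (e a) u"
    using pd_commute[OF open_V assms smooth_x] .
  ultimately show ?thesis by (simp add: cov_eq)
qed

text \<open>
  All derivatives of the vector field cancel in the commutator: the second ones because they
  commute, the first ones because each appears in both orders. What remains is a matrix.
\<close>

lemma curvature_eq:
  assumes "u \<in> V"
  shows "cov a (cov b (N A)) u - cov b (cov a (N A)) u =
    (pd a (conn b) u - pd b (conn a) u) *v N A u
     + (conn a u *v (conn b u *v N A u) - conn b u *v (conn a u *v N A u))"
proof -
  have "cov a (cov b (N A)) u = pd a (pd b (N A)) u + pd a (conn b) u *v N A u
      + conn b u *v pd a (N A) u + conn a u *v pd b (N A) u + conn a u *v (conn b u *v N A u)" for a b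
    using assms unfolding cov_eq[abs_def] cov_eq
    by (simp add: pd_add pd_matrix_vector_mult differentiable_conn differentiable_N
        differentiable_pd_N differentiable_matrix_vector_mult matrix_vector_right_distrib)
  then show ?thesis
    using pd_commute[OF open_V assms smooth_N, of a b A]
    by (simp add: matrix_vector_mult_diff_rdistrib)
qed


subsection \<open>The induced metric\<close>

lemma g_entry: "g u $ a $ b = metric u (e a u) (e b u)"
  by (simp add: induced_metric_def)

lemma g_sym: "u \<in> V \<Longrightarrow> transpose (g u) = g u"
  by (simp add: vec_eq_iff transpose_def g_entry metric_commute)

lemma differentiable_g: "u \<in> V \<Longrightarrow> g differentiable at u"
  by (intro differentiable_vecI)
    (simp add: g_entry differentiable_ip differentiable_G_x differentiable_e)

lemma pushforward_eq: "u \<in> V \<Longrightarrow> pushforward x u = frechet_derivative x (at u)"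
  unfolding pushforward_def[abs_def] pd_def
  by (intro ext linear_axis_expansion[symmetric] linear_frechet_derivative differentiable_x)

lemma linear_pushforward: "u \<in> V \<Longrightarrow> linear (pushforward x u)"
  unfolding pushforward_eq by (intro linear_frechet_derivative differentiable_x)

lemma pushforward_eq_0_iff:
  assumes "u \<in> V"
  shows "pushforward x u X = 0 \<longleftrightarrow> X = 0"
proof -
  have "inj (pushforward x u)" using immersion[OF assms] by (simp only: pushforward_eq[OF assms])
  then show ?thesis
    using linear_injective_0[OF linear_pushforward[OF assms]] linear_0[OF linear_pushforward[OF assms]] by blast
qed

lemma metric_pushforward: "u \<in> V \<Longrightarrow> metric u (pushforward x u X) (e d u) = (g u *v X) $ d"
  by (simp add: pushforward_def ip_sum ip_bilinear matrix_vector_mult_def g_entry metric_commute[of u "e d u"] mult.commute)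

lemma g_pos:
  assumes "u \<in> V" "X \<noteq> 0"
  shows "X \<bullet> (g u *v X) > 0"
proof -
  have "X \<bullet> (g u *v X) = metric u (pushforward x u X) (pushforward x u X)"
    unfolding pushforward_def[of x u X, THEN arg_cong, of "metric u (pushforward x u X)"]
    by (simp add: ip_sum ip_bilinear metric_pushforward[OF assms(1)] inner_vec_def)
  also have "\<dots> > 0"
    unfolding ip_eq_inner using assms by (intro G_pos x_in_U) (simp_all add: pushforward_eq_0_iff)
  finally show ?thesis .
qed

lemma g_invertible: "u \<in> V \<Longrightarrow> invertible (g u)"
  using g_pos by (rule invertible_if_positive)

lemma det_g_pos: "u \<in> V \<Longrightarrow> det (g u) > 0"
  using g_pos by (rule det_pos_if_positive)

subsection \<open>Tangential and normal parts\<close>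

text \<open>
  The components with respect to $e_a$ of the orthogonal projection of \<open>w\<close> to the tangent space,
  obtained by solving $g_{db}X^b = \bar g(w, e_d)$ (see \<open>normal_part_iff\<close>).
\<close>

definition tangent_coords :: "real^'n \<Rightarrow> real^'m \<Rightarrow> real^'n" where
  "tangent_coords u w = matrix_inv (g u) *v (\<chi> d. metric u w (e d u))"

lemma linear_tangent_coords: "linear (tangent_coords u)"
proof (rule linearI)
  fix v w and r :: real
  have "(\<chi> d. metric u (v + w) (e d u)) = (\<chi> d. metric u v (e d u)) + (\<chi> d. metric u w (e d u))"
    and "(\<chi> d. metric u (r *\<^sub>R v) (e d u)) = r *\<^sub>R (\<chi> d. metric u v (e d u))"
    by (simp_all add: vec_eq_iff ip_bilinear)
  then show "tangent_coords u (v + w) = tangent_coords u v + tangent_coords u w"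
    and "tangent_coords u (r *\<^sub>R v) = r *\<^sub>R tangent_coords u v"
    by (simp_all add: tangent_coords_def matrix_vector_right_distrib matrix_vector_mult_scaleR)
qed

lemma tangent_coords_lower: "u \<in> V \<Longrightarrow> (g u *v tangent_coords u w) $ d = metric u w (e d u)"
  by (simp add: tangent_coords_def matrix_vector_mul_assoc matrix_inv_cancel g_invertible)

lemma g_cancel:
  assumes "u \<in> V" "\<And>d. (g u *v X) $ d = (g u *v Y) $ d"
  shows "X = Y"
proof -
  have "g u *v X = g u *v Y" using assms(2) by (simp add: vec_eq_iff)
  then have "matrix_inv (g u) *v (g u *v X) = matrix_inv (g u) *v (g u *v Y)" by simp
  then show ?thesis by (simp add: matrix_vector_mul_assoc matrix_inv_cancel g_invertible assms(1))
qed

lemma normal_vector_iff: "normal_vector G x u w \<longleftrightarrow> (\<forall>d. metric u w (e d u) = 0)"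
proof
  assume w: "normal_vector G x u w"
  show "\<forall>d. metric u w (e d u) = 0"
  proof
    fix d
    have "pushforward x u (axis d 1) = e d u"
      by (simp add: pushforward_def axis_def if_distrib[of "\<lambda>c. c *\<^sub>R _"] cong: if_cong)
    then show "metric u w (e d u) = 0" using w unfolding normal_vector_def by metis
  qed
qed (simp add: normal_vector_def pushforward_def ip_sum ip_bilinear)

lemma normal_part_iff:
  assumes "u \<in> V"
  shows "normal_vector G x u (w - pushforward x u X) \<longleftrightarrow> X = tangent_coords u w"
proof -
  have "normal_vector G x u (w - pushforward x u X) \<longleftrightarrow> (\<forall>d. (g u *v X) $ d = (g u *v tangent_coords u w) $ d)"
    by (auto simp: normal_vector_iff ip_bilinear metric_pushforward tangent_coords_lower assms)
  then show ?thesis using g_cancel[OF assms] by blast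
qed

text \<open>
  The decomposition into a tangential and a normal part exists and is unique, so the definite
  description denotes the projection.
\<close>

lemma weingarten_eq:
  assumes "u \<in> V"
  shows "weingarten G x N A X u = - tangent_coords u (covariant_derivative_along G x X (N A) u)"
proof -
  let ?D = "covariant_derivative_along G x X (N A) u"
  have "(\<exists>v. normal_vector G x u v \<and> ?D = - pushforward x u w + v) \<longleftrightarrow> w = - tangent_coords u ?D" for w
  proof -
    have "(\<exists>v. normal_vector G x u v \<and> ?D = - pushforward x u w + v)
        \<longleftrightarrow> normal_vector G x u (?D - pushforward x u (- w))"
      by (auto simp: linear_neg[OF linear_pushforward[OF assms]] intro: exI[of _ "?D + pushforward x u w"])
    also have "\<dots> \<longleftrightarrow> - w = tangent_coords u ?D" by (rule normal_part_iff[OF assms])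
    finally show ?thesis by (metis minus_minus)
  qed
  then show ?thesis by (simp add: weingarten_def)
qed

lemma normal_connection_eq:
  assumes "u \<in> V"
  shows "normal_connection G x N A X u = covariant_derivative_along G x X (N A) u
    - pushforward x u (tangent_coords u (covariant_derivative_along G x X (N A) u))"
proof -
  let ?D = "covariant_derivative_along G x X (N A) u"
  have "(normal_vector G x u v \<and> (\<exists>w. ?D = - pushforward x u w + v)) \<longleftrightarrow>
      v = ?D - pushforward x u (tangent_coords u ?D)" for v
  proof -
    have "(normal_vector G x u v \<and> (\<exists>w. ?D = - pushforward x u w + v)) \<longleftrightarrow>
       (\<exists>w. v = ?D - pushforward x u (- w) \<and> normal_vector G x u (?D - pushforward x u (- w)))"
      by (auto simp: linear_neg[OF linear_pushforward[OF assms]])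
    also have "\<dots> \<longleftrightarrow> (\<exists>w. v = ?D - pushforward x u (- w) \<and> - w = tangent_coords u ?D)"
      unfolding normal_part_iff[OF assms] ..
    also have "\<dots> \<longleftrightarrow> v = ?D - pushforward x u (tangent_coords u ?D)"
      by (metis minus_minus)
    finally show ?thesis .
  qed
  then show ?thesis by (simp add: normal_connection_def)
qed

lemma normal_connection_normal: "u \<in> V \<Longrightarrow> normal_vector G x u (normal_connection G x N A X u)"
  by (simp add: normal_connection_eq normal_part_iff)

lemma cov_N_decompose:
  "u \<in> V \<Longrightarrow> covariant_derivative_along G x X (N A) u
     = normal_connection G x N A X u - pushforward x u (weingarten G x N A X u)"
  by (simp add: normal_connection_eq weingarten_eq linear_neg[OF linear_pushforward])

lemma N_normal: "u \<in> V \<Longrightarrow> normal_vector G x u (N A u)"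
  and N_orthonormal: "u \<in> V \<Longrightarrow> metric u (N A u) (N B u) = (if A = B then 1 else 0)"
  using normals by (auto simp: orthonormal_normal_fields_def)

lemma metric_normal_pushforward: "normal_vector G x u w \<Longrightarrow> metric u w (pushforward x u X) = 0"
  by (simp add: normal_vector_def)

text \<open>
  The tangent and normal frames are jointly independent: pairing a combination with $N_B$
  isolates the coefficient of $N_B$, and $dx$ is injective. As their number is the
  dimension of \<open>M\<close>, they span.
\<close>

lemma frame_expansion:
  assumes u: "u \<in> V"
  obtains X c where "w = pushforward x u X + (\<Sum>B\<in>UNIV. c $ B *\<^sub>R N B u)"
proof -
  define L where "L p = pushforward x u (fst p) + (\<Sum>B\<in>UNIV. snd p $ B *\<^sub>R N B u)" for p :: "(real^'n) \<times> (real^'p)"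
  have lin: "linear L"
    unfolding L_def using linear_pushforward[OF u]
    by (intro linearI) (simp_all add: linear_add linear_cmul scaleR_add_left sum.distrib scaleR_right_distrib scaleR_sum_right)
  have "p = 0" if "L p = 0" for p
  proof -
    have c: "snd p $ B = 0" for B
    proof -
      have "metric u (N B u) (L p) = snd p $ B"
        using u by (simp add: L_def ip_bilinear ip_sum metric_normal_pushforward N_normal N_orthonormal
            if_distrib[of "\<lambda>c. _ * c"] cong: if_cong)
      then show ?thesis using that by (simp add: ip_eq_inner)
    qed
    then have "pushforward x u (fst p) = 0" using that by (simp add: L_def)
    then have "fst p = 0" using u by (simp add: pushforward_eq_0_iff)
    moreover have "snd p = 0" using c by (simp add: vec_eq_iff)
    ultimately show "p = 0" by (simp add: prod_eq_iff)
  qed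
  then have "inj L" using lin by (simp add: linear_injective_0)
  then have "dim (range L) = DIM(real^'m)"
    using dim_image_eq[OF lin, of UNIV] codim by (simp add: dim_UNIV)
  then have "range L = UNIV"
    using dim_eq_full[of "range L"] linear_subspace_image[OF lin subspace_UNIV] span_eq_iff by metis
  then obtain p where "w = L p" by blast
  then show ?thesis using that by (simp add: L_def)
qed

text \<open>
  The difference between \<open>w\<close> and its expansion in the $N_B$ is orthogonal to the whole frame, hence
  to itself.
\<close>

lemma normal_expansion:
  assumes u: "u \<in> V" and w: "normal_vector G x u w"
  shows "metric u w z = (\<Sum>B\<in>UNIV. metric u w (N B u) * metric u (N B u) z)"
proof -
  define y where "y = w - (\<Sum>B\<in>UNIV. metric u w (N B u) *\<^sub>R N B u)"
  have "metric u y (pushforward x u X) = 0" for X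
    using metric_normal_pushforward[OF w] metric_normal_pushforward[OF N_normal[OF u]]
    by (simp add: y_def ip_bilinear ip_sum)
  moreover have "metric u y (N B u) = 0" for B
    using u by (simp add: y_def ip_bilinear ip_sum N_orthonormal if_distrib[of "\<lambda>c. _ * c"] cong: if_cong)
  moreover obtain X c where "y = pushforward x u X + (\<Sum>B\<in>UNIV. c $ B *\<^sub>R N B u)"
    by (rule frame_expansion[OF u])
  ultimately have "metric u y y = 0" by (simp add: ip_bilinear ip_sum)
  then have "y = 0" using G_pos[OF x_in_U[OF u], of y] by (auto simp: ip_eq_inner)
  then have "w = (\<Sum>B\<in>UNIV. metric u w (N B u) *\<^sub>R N B u)" by (simp add: y_def)
  then have "metric u w z = metric u (\<Sum>B\<in>UNIV. metric u w (N B u) *\<^sub>R N B u) z" by simp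
  then show ?thesis by (simp add: ip_sum ip_bilinear)
qed

subsection \<open>The induced connection\<close>

text \<open>
  This is the tangential part of the Gauss formula: the Levi-Civita connection of the induced metric is
  the tangential part of the ambient connection. It is Koszul's computation: differentiate
  $g_{ab} = \bar g(e_a,e_b)$ with metric compatibility, and cancel with $D_ae_b = D_be_a$.
\<close>

lemma induced_christoffel_lower:
  assumes "u \<in> V"
  shows "(\<Sum>c\<in>UNIV. g u $ d $ c * christoffel g c a b u) = metric u (cov a (e b) u) (e d u)"
proof -
  have pd_g: "pd a (\<lambda>v. g v $ b $ c) u = metric u (cov a (e b) u) (e c u) + metric u (cov a (e c) u) (e b u)" for a b c
    using assms by (simp add: g_entry metric_compatible differentiable_e metric_commute[of u "e b u"])
  show ?thesis
    unfolding christoffel_lower[where g=g and z=u, OF g_invertible[OF assms]] pd_g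
    using torsion_free[OF assms, of b a] torsion_free[OF assms, of d a] torsion_free[OF assms, of d b]
    by (simp add: field_simps)
qed

text \<open>
  In lowered form the covariant derivative of the induced metric only involves ambient quantities:
  $g(\nabla_aY, e_d) = \partial_a\,g(Y,e_d) - \bar g(D_ae_d, Y)$.
\<close>

lemma induced_covariant_lower:
  assumes u: "u \<in> V" and Y: "Y differentiable at u"
  shows "(g u *v covariant_derivative g (axis a 1) Y u) $ d
    = pd a (\<lambda>v. (g v *v Y v) $ d) u - metric u (cov a (e d) u) (pushforward x u (Y u))"
proof -
  define C where "C = (\<chi> c b. christoffel g c a b u)"
  have cd: "covariant_derivative g (axis a 1) Y u = pd a Y u + C *v Y u"
    by (simp add: vec_eq_iff covariant_derivative_def axis_sum C_def matrix_vector_mult_def)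
  have gC: "(g u ** C) $ d $ b = metric u (cov a (e b) u) (e d u)" for b
    using induced_christoffel_lower[OF u] by (simp add: matrix_matrix_mult_def C_def)
  have pd_g: "pd a g u $ d $ b = metric u (cov a (e d) u) (e b u) + metric u (cov a (e b) u) (e d u)" for b
    using u by (simp add: pd_entry[symmetric] differentiable_g g_entry metric_compatible
        differentiable_e metric_commute[of u "e d u"])
  have "pd a (\<lambda>v. (g v *v Y v) $ d) u = (pd a g u *v Y u) $ d + (g u *v pd a Y u) $ d"
    using u Y by (simp add: pd_component pd_matrix_vector_mult differentiable_matrix_vector_mult differentiable_g)
  moreover have "(pd a g u *v Y u) $ d = metric u (cov a (e d) u) (pushforward x u (Y u)) + ((g u ** C) *v Y u) $ d"
    by (simp add: matrix_vector_mult_def pd_g gC pushforward_def ip_sum ip_bilinear distrib_left sum.distrib mult.commute)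
  ultimately show ?thesis
    by (simp add: cd matrix_vector_right_distrib matrix_vector_mul_assoc)
qed

subsection \<open>The Codazzi-Mainardi equation\<close>

lemma weingarten_lower: "u \<in> V \<Longrightarrow> (g u *v weingarten G x N A X u) $ d
    = - metric u (covariant_derivative_along G x X (N A) u) (e d u)"
  by (simp add: weingarten_eq vec.neg tangent_coords_lower)

lemma differentiable_weingarten:
  assumes "u \<in> V"
  shows "(\<lambda>v. weingarten G x N A (axis b 1) v) differentiable at u"
proof (rule differentiable_cong_open[OF open_V assms])
  show "- tangent_coords v (cov b (N A) v) = weingarten G x N A (axis b 1) v" if "v \<in> V" for v
    using that by (simp add: weingarten_eq)
  have "(\<lambda>v. matrix_inv (g v)) differentiable at u"
    by (intro differentiable_vecI differentiable_matrix_inv[OF open_V assms])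
      (simp_all add: g_invertible differentiable_entry differentiable_g assms)
  moreover have "(\<lambda>v. \<chi> d. metric v (cov b (N A) v) (e d v)) differentiable at u"
    by (intro differentiable_vecI)
      (simp add: differentiable_ip differentiable_G_x differentiable_cov_N differentiable_e assms)
  ultimately show "(\<lambda>v. - tangent_coords v (cov b (N A) v)) differentiable at u"
    unfolding tangent_coords_def by (intro differentiable_minus differentiable_matrix_vector_mult)
qed

text \<open>
  Differentiate $\bar g(N_A,N_B) = \delta_{AB}$.
\<close>

lemma metric_N_cov_N:
  assumes u: "u \<in> V"
  shows "metric u (cov a (N A) u) (N B u) = - metric u (cov a (N B) u) (N A u)"
proof -
  have "pd a (\<lambda>v. metric v (N A v) (N B v)) u = pd a (\<lambda>_. if A = B then 1 else 0) u"
    by (rule pd_cong_open[OF open_V u])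
     (simp_all add: N_orthonormal differentiable_ip differentiable_G_x differentiable_N u)
  then show ?thesis
    using u by (simp add: pd_const metric_compatible differentiable_N metric_commute[of u "N A u"])
qed

text \<open>
  Differentiate $\bar g(N_B,e_d) = 0$.
\<close>

lemma metric_N_cov_e:
  assumes u: "u \<in> V"
  shows "metric u (N B u) (cov a (e d) u) = - metric u (cov a (N B) u) (e d u)"
proof -
  have "pd a (\<lambda>v. metric v (N B v) (e d v)) u = pd a (\<lambda>_. 0) u"
    by (rule pd_cong_open[OF open_V u])
     (use N_normal in \<open>auto simp: normal_vector_iff differentiable_ip differentiable_G_x differentiable_N differentiable_e u\<close>)
  then show ?thesis
    using u by (simp add: pd_const metric_compatible differentiable_N differentiable_e)
qed

lemma metric_normal_connection_N:
  assumes "u \<in> V"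
  shows "metric u (normal_connection G x N A X u) (N B u)
    = metric u (covariant_derivative_along G x X (N A) u) (N B u)"
  using assms metric_commute[OF assms, of "pushforward x u _" "N B u"]
  by (simp add: cov_N_decompose ip_bilinear metric_normal_pushforward N_normal)

text \<open>
  Start from $g(W_A(e_b),e_d) = -\bar g(D_bN_A,e_d)$ and differentiate along $e_a$. The derivative falls
  on $D_bN_A$, which gives the second derivative of $N_A$, or on $e_d$. In the latter term the
  tangential part of $D_bN_A$ cancels against the correction in \<open>induced_covariant_lower\<close>, and its
  normal part is expanded in the $N_B$.
\<close>

lemma nabla_weingarten_lower:
  assumes u: "u \<in> V"
  shows "(g u *v covariant_derivative g (axis a 1) (\<lambda>v. weingarten G x N A (axis b 1) v) u) $ d
    = - metric u (cov a (cov b (N A)) u) (e d u)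
      + (\<Sum>B\<in>UNIV. metric u (normal_connection G x N B (axis b 1) u) (N A u)
           * (g u *v weingarten G x N B (axis a 1) u) $ d)"
proof -
  let ?W = "weingarten G x N A (axis b 1)" and ?D = "normal_connection G x N A (axis b 1) u"
  have "pd a (\<lambda>v. (g v *v ?W v) $ d) u = pd a (\<lambda>v. - metric v (cov b (N A) v) (e d v)) u"
    by (rule pd_cong_open[OF open_V u])
      (simp_all add: weingarten_lower differentiable_component differentiable_matrix_vector_mult
        differentiable_g differentiable_weingarten u)
  also have "\<dots> = - metric u (cov a (cov b (N A)) u) (e d u) - metric u (cov b (N A) u) (cov a (e d) u)"
    using u by (simp add: pd_minus differentiable_ip differentiable_G_x differentiable_cov_N
        differentiable_e metric_compatible)
  also have "metric u (cov b (N A) u) (cov a (e d) u)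
      = metric u ?D (cov a (e d) u) - metric u (cov a (e d) u) (pushforward x u (?W u))"
    using u metric_commute[OF u, of "pushforward x u (?W u)" "cov a (e d) u"]
    by (simp add: cov_N_decompose[OF u] ip_bilinear)
  also have "metric u ?D (cov a (e d) u) =
      (\<Sum>B\<in>UNIV. metric u ?D (N B u) * metric u (N B u) (cov a (e d) u))"
    by (rule normal_expansion[OF u normal_connection_normal[OF u]])
  also have "\<dots> = - (\<Sum>B\<in>UNIV. metric u (normal_connection G x N B (axis b 1) u) (N A u)
           * (g u *v weingarten G x N B (axis a 1) u) $ d)"
    unfolding metric_normal_connection_N[OF u] metric_N_cov_N[OF u, of b A] weingarten_lower[OF u] metric_N_cov_e[OF u]
    by (simp add: sum_negf)
  finally show ?thesis
    by (simp add: induced_covariant_lower u differentiable_weingarten)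
qed

text \<open>
  Antisymmetrizing \<open>nabla_weingarten_lower\<close> in $a,b$ produces the commutator of the covariant
  derivatives and exactly the negative of the normal connection terms in the definition of
  $\mathcal{W}_A$. The terms $W_A(\nabla_{e_a}e_b)$ cancel because the induced connection is torsion free.
\<close>

lemma codazzi:
  assumes u: "u \<in> V"
  shows "curly_W G x N A (\<lambda>_. axis a 1) (\<lambda>_. axis b 1) u
    = - tangent_coords u (cov a (cov b (N A)) u - cov b (cov a (N A)) u)"
proof (rule g_cancel[OF u])
  fix d
  have "christoffel g c a b u = christoffel g c b a u" for c
    by (rule christoffel_commute[OF open_V u g_sym differentiable_g[OF u]])
  then have sym: "covariant_derivative g (axis a 1) (\<lambda>_. axis b 1) u = covariant_derivative g (axis b 1) (\<lambda>_. axis a 1) u"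
    by (simp add: vec_eq_iff covariant_derivative_def axis_sum pd_const mult.commute[of "christoffel _ _ _ _ _"])
  let ?n = "\<lambda>a B. metric u (normal_connection G x N B (axis a 1) u) (N A u)"
  let ?W = "\<lambda>a B. weingarten G x N B (axis a 1) u"
  have "curly_W G x N A (\<lambda>_. axis a 1) (\<lambda>_. axis b 1) u =
     covariant_derivative g (axis a 1) (\<lambda>v. weingarten G x N A (axis b 1) v) u
     - covariant_derivative g (axis b 1) (\<lambda>v. weingarten G x N A (axis a 1) v) u
     + (\<Sum>B\<in>UNIV. ?n a B *\<^sub>R ?W b B - ?n b B *\<^sub>R ?W a B)"
    by (simp add: curly_W_def nabla_weingarten_def sym)
  then show "(g u *v curly_W G x N A (\<lambda>_. axis a 1) (\<lambda>_. axis b 1) u) $ d =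
      (g u *v - tangent_coords u (cov a (cov b (N A)) u - cov b (cov a (N A)) u)) $ d"
    by (simp add: matrix_vector_right_distrib matrix_vector_mult_diff_distrib vec.sum vec.neg
        matrix_vector_mult_scaleR nabla_weingarten_lower[OF u] tangent_coords_lower[OF u] ip_bilinear sum_subtractf)
qed

end


section \<open>The bracket and $\mathcal{P}^2$\<close>

text \<open>
  Distributivity: a sum over multi-indices of a product with separated indices factorizes.
\<close>

lemma sum_multi_indices_prod:
  fixes F :: "nat \<Rightarrow> 'k::finite \<Rightarrow> real"
  shows "(\<Sum>I\<in>multi_indices n. \<Prod>r<n. F r (I ! r)) = (\<Prod>r<n. \<Sum>i\<in>UNIV. F r i)"
proof (induction n arbitrary: F)
  case 0
  then show ?case by (simp add: multi_indices_def)
next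
  case (Suc n)
  have "(\<Sum>I\<in>multi_indices (Suc n). \<Prod>r<Suc n. F r (I ! r))
      = (\<Sum>i\<in>UNIV. \<Sum>I\<in>multi_indices n. F 0 i * (\<Prod>r<n. F (Suc r) (I ! r)))"
    by (simp only: sum_multi_indices_Suc prod.lessThan_Suc_shift nth_Cons_0 nth_Cons_Suc)
  also have "\<dots> = (\<Sum>i\<in>UNIV. F 0 i) * (\<Prod>r<n. \<Sum>i\<in>UNIV. F (Suc r) i)"
    by (simp add: sum_distrib_left[symmetric] Suc.IH[of "\<lambda>r. F (Suc r)"] sum_distrib_right)
  finally show ?case by (simp only: prod.lessThan_Suc_shift)
qed

lemma bracket_Cons:
  fixes u :: "'n::{finite, linorder} coords"
  shows "bracket \<rho> (f # fs) u = 1 / \<rho> u * (\<Sum>a\<in>UNIV. \<Sum>as\<in>multi_indices (CARD('n) - 1).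
     levi_civita (a # as) * (pd a f u * (\<Prod>r<CARD('n) - 1. pd (as ! r) (fs ! r) u)))"
proof -
  have n: "CARD('n) = Suc (CARD('n) - 1)" by simp
  show ?thesis
    unfolding bracket_def
    by (subst (1 2) n) (simp only: sum_multi_indices_Suc prod_lessThan_Cons[where P="\<lambda>a f. pd a f u"])
qed

text \<open>
  The coefficients $T^{ab}$ of a bracket as a bilinear form in the differentials of its first two
  arguments. They absorb the density and the remaining arguments; the proof rests on their
  antisymmetry in $a,b$.
\<close>

definition bracket_tensor ::
  "('n::{finite, linorder} coords \<Rightarrow> real) \<Rightarrow> ('n coords \<Rightarrow> real) list \<Rightarrow> 'n coords \<Rightarrow> 'n \<Rightarrow> 'n \<Rightarrow> real" where
  "bracket_tensor \<rho> fs u a b = 1 / \<rho> u * (\<Sum>as\<in>multi_indices (CARD('n) - 2).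
     levi_civita (a # b # as) * (\<Prod>r<CARD('n) - 2. pd (as ! r) (fs ! r) u))"

lemma bracket_tensor_swap: "bracket_tensor \<rho> fs u b a = - bracket_tensor \<rho> fs u a b"
  unfolding bracket_tensor_def levi_civita_swap[of b a] by (simp add: sum_negf)

lemma bracket_Cons_Cons:
  fixes u :: "'n::{finite, linorder} coords"
  assumes "CARD('n) \<ge> 2"
  shows "bracket \<rho> (p # q # fs) u
    = (\<Sum>a\<in>UNIV. \<Sum>b\<in>UNIV. bracket_tensor \<rho> fs u a b * (pd a p u * pd b q u))"
proof -
  have n: "CARD('n) - 1 = Suc (CARD('n) - 2)" using assms by simp
  show ?thesis
    unfolding bracket_Cons bracket_tensor_def n sum_multi_indices_Suc prod_lessThan_Cons[where P="\<lambda>a f. pd a f u"]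
    by (simp add: sum_distrib_left sum_distrib_right mult_ac)
qed

lemma curly_C_eq:
  "curly_C G x N \<rho> A fs u = (1/2) *\<^sub>R (\<Sum>a\<in>UNIV. \<Sum>b\<in>UNIV. bracket_tensor \<rho> fs u a b *\<^sub>R
     curly_W G x N A (\<lambda>_. axis a 1) (\<lambda>_. axis b 1) u)"
  by (simp add: curly_C_def bracket_tensor_def scaleR_sum_right scaleR_sum_left sum_distrib_left mult_ac)

lemma sum_antisymmetric:
  fixes K :: "'n::finite \<Rightarrow> 'n \<Rightarrow> 'v::real_vector"
  assumes "\<And>a b. T b a = - T a b"
  shows "(\<Sum>a\<in>UNIV. \<Sum>b\<in>UNIV. T a b *\<^sub>R K a b)
    = (1/2) *\<^sub>R (\<Sum>a\<in>UNIV. \<Sum>b\<in>UNIV. T a b *\<^sub>R (K a b - K b a))"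
proof -
  have "(\<Sum>a\<in>UNIV. \<Sum>b\<in>UNIV. T a b *\<^sub>R K b a) = (\<Sum>a\<in>UNIV. \<Sum>b\<in>UNIV. T b a *\<^sub>R K a b)"
    by (rule sum.swap)
  also have "\<dots> = - (\<Sum>a\<in>UNIV. \<Sum>b\<in>UNIV. T a b *\<^sub>R K a b)"
    unfolding sum_negf[symmetric] by (intro sum.cong refl) (subst assms, simp)
  finally show ?thesis
    by (simp add: scaleR_diff_right sum_subtractf scaleR_add_left[symmetric] scaleR_2[symmetric])
qed

text \<open>
  Multiply the left-hand side, as a matrix in $a,b$, by \<open>g\<close>. The sum over \<open>b\<close> and \<open>bs\<close> then becomes a
  complete determinant expansion, equal to $\varepsilon^{c\,as}\det g$, and contracting the two
  remaining Levi-Civita symbols gives a multiple of the identity.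
\<close>

lemma levi_civita_cofactors:
  fixes g :: "((real, 'n::{finite, linorder}) vec, 'n) vec"
  assumes sym: "transpose g = g" and inv: "invertible g"
  shows "(\<Sum>as\<in>multi_indices (CARD('n) - 1). \<Sum>bs\<in>multi_indices (CARD('n) - 1).
       levi_civita (a # as) * levi_civita (b # bs) * (\<Prod>r<CARD('n) - 1. g $ (as ! r) $ (bs ! r)))
    = fact (CARD('n) - 1) * det g * matrix_inv g $ a $ b"
proof -
  let ?L = "multi_indices (CARD('n) - 1) :: 'n list set"
  define Q :: "((real, 'n) vec, 'n) vec" where "Q = (\<chi> a b. \<Sum>as\<in>?L. \<Sum>bs\<in>?L.
       levi_civita (a # as) * levi_civita (b # bs) * (\<Prod>r<CARD('n) - 1. g $ (as ! r) $ (bs ! r)))"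
  have n: "CARD('n) = Suc (CARD('n) - 1)" by simp
  have g: "g $ i $ j = g $ j $ i" for i j using sym by (auto simp: vec_eq_iff transpose_def)
  have "(Q ** g) $ a $ c = fact (CARD('n) - 1) * det g * mat 1 $ a $ c" for a c
  proof -
    have "(Q ** g) $ a $ c = (\<Sum>b\<in>UNIV. \<Sum>as\<in>?L. \<Sum>bs\<in>?L. levi_civita (a # as) *
        (levi_civita (b # bs) * (g $ c $ b * (\<Prod>r<CARD('n) - 1. g $ (as ! r) $ (bs ! r)))))"
      by (simp add: matrix_matrix_mult_def Q_def sum_distrib_right sum_distrib_left g[of _ c] mult_ac)
    also have "\<dots> = (\<Sum>as\<in>?L. levi_civita (a # as) * (\<Sum>b\<in>UNIV. \<Sum>bs\<in>?L.
        levi_civita (b # bs) * (g $ c $ b * (\<Prod>r<CARD('n) - 1. g $ (as ! r) $ (bs ! r)))))"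
      by (subst sum.swap) (simp add: sum_distrib_left)
    also have "\<dots> = (\<Sum>as\<in>?L. levi_civita (a # as) * (levi_civita (c # as) * det g))"
    proof (intro sum.cong refl arg_cong2[where f="(*)"])
      fix as assume "as \<in> ?L"
      then have "length (c # as) = CARD('n)" by (simp add: multi_indices_def)
      from sum_levi_civita_prod[OF this, of g]
      show "(\<Sum>b\<in>UNIV. \<Sum>bs\<in>?L. levi_civita (b # bs) * (g $ c $ b * (\<Prod>r<CARD('n) - 1. g $ (as ! r) $ (bs ! r))))
          = levi_civita (c # as) * det g"
        by (subst (asm) (1 2) n) (simp only: sum_multi_indices_Suc prod_lessThan_Cons[where P="\<lambda>i j. g $ i $ j"])
    qed
    also have "\<dots> = (\<Sum>as\<in>?L. levi_civita (a # as) * levi_civita (c # as)) * det g"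
      by (simp add: sum_distrib_right sum_distrib_left mult_ac)
    finally show ?thesis unfolding sum_levi_civita_contract by (simp add: mat_def)
  qed
  then have "Q ** g = (fact (CARD('n) - 1) * det g) *\<^sub>R mat 1" by (simp add: vec_eq_iff)
  then have "Q ** (g ** matrix_inv g) = ((fact (CARD('n) - 1) * det g) *\<^sub>R mat 1) ** matrix_inv g"
    by (simp add: matrix_mul_assoc)
  then have "Q = (fact (CARD('n) - 1) * det g) *\<^sub>R matrix_inv g"
    by (simp add: matrix_inv_cancel inv scalar_matrix_assoc[symmetric])
  then show ?thesis by (simp add: Q_def vec_eq_iff)
qed

text \<open>
  After expanding both brackets, the sums over \<open>I\<close> and \<open>J\<close> contract each factor
  $\bar g_{i_rj_r}$ with two derivatives of $x$, which turns it into an entry of the induced metric. The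
  factorial from \<open>levi_civita_cofactors\<close> is absorbed by the normalization of $\mathcal{P}$.
\<close>

lemma P2_upper_eq:
  fixes x :: "'n::{finite, linorder} coords \<Rightarrow> real^'m::finite"
  assumes x: "x differentiable at u"
    and sym: "transpose (induced_metric G x u) = induced_metric G x u"
    and inv: "invertible (induced_metric G x u)" and det: "det (induced_metric G x u) \<ge> 0"
  shows "P2_upper G x \<rho> i k u = (gamma G x \<rho> u)\<^sup>2 *
    (\<Sum>a\<in>UNIV. \<Sum>b\<in>UNIV. matrix_inv (induced_metric G x u) $ a $ b * pd a x u $ i * pd b x u $ k)"
proof -
  let ?n = "CARD('n) - 1"
  let ?L = "multi_indices ?n :: 'n list set" and ?M = "multi_indices ?n :: 'm list set"
  let ?g = "induced_metric G x u"
  define D where "D as I = (\<Prod>r<?n. pd (as ! r) x u $ (I ! r))" for as :: "'n list" and I :: "'m list"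
  define H where "H I J = (\<Prod>r<?n. G (x u) $ (I ! r) $ (J ! r))" for I J :: "'m list"
  have P: "curly_P x \<rho> i I u = 1 / (sqrt (fact ?n) * \<rho> u) *
      (\<Sum>a\<in>UNIV. \<Sum>as\<in>?L. levi_civita (a # as) * pd a x u $ i * D as I)" if "I \<in> ?M" for i I
    using that unfolding curly_P_def list.map bracket_Cons D_def
    by (simp add: multi_indices_def pd_component[OF x] mult_ac)
  have contract: "(\<Sum>I\<in>?M. \<Sum>J\<in>?M. D as I * D bs J * H I J) = (\<Prod>r<?n. ?g $ (as ! r) $ (bs ! r))" for as bs
  proof -
    have "(\<Sum>J\<in>?M. D as I * D bs J * H I J) = (\<Prod>r<?n. \<Sum>j\<in>UNIV.
        G (x u) $ (I ! r) $ j * pd (as ! r) x u $ (I ! r) * pd (bs ! r) x u $ j)" for I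
      unfolding D_def H_def
      by (subst sum_multi_indices_prod[symmetric]) (simp add: prod.distrib mult_ac)
    then show ?thesis
      using sum_multi_indices_prod[where n="?n" and F="\<lambda>r i. \<Sum>j\<in>UNIV. G (x u) $ i $ j * pd (as ! r) x u $ i * pd (bs ! r) x u $ j"]
      by (simp add: induced_metric_def ip_def)
  qed
  have "P2_upper G x \<rho> i k u = (\<Sum>I\<in>?M. \<Sum>J\<in>?M. 1 / (fact ?n * (\<rho> u)\<^sup>2) *
     (\<Sum>a\<in>UNIV. \<Sum>as\<in>?L. \<Sum>b\<in>UNIV. \<Sum>bs\<in>?L. levi_civita (a # as) * levi_civita (b # bs) *
        pd a x u $ i * pd b x u $ k * (D as I * D bs J * H I J)))"
    unfolding P2_upper_def H_def[symmetric]
  proof (intro sum.cong refl)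
    fix I J assume "I \<in> ?M" "J \<in> ?M"
    have "(\<Sum>a\<in>UNIV. \<Sum>as\<in>?L. \<Sum>b\<in>UNIV. \<Sum>bs\<in>?L. levi_civita (a # as) * levi_civita (b # bs) *
        pd a x u $ i * pd b x u $ k * (D as I * D bs J * H I J))
      = (\<Sum>a\<in>UNIV. \<Sum>as\<in>?L. levi_civita (a # as) * pd a x u $ i * D as I) *
        (\<Sum>b\<in>UNIV. \<Sum>bs\<in>?L. levi_civita (b # bs) * pd b x u $ k * D bs J) * H I J"
      unfolding sum_distrib_right unfolding sum_distrib_left
      by (simp add: sum_distrib_right sum_distrib_left mult_ac)
    then show "curly_P x \<rho> i I u * curly_P x \<rho> k J u * H I J = 1 / (fact ?n * (\<rho> u)\<^sup>2) *
       (\<Sum>a\<in>UNIV. \<Sum>as\<in>?L. \<Sum>b\<in>UNIV. \<Sum>bs\<in>?L. levi_civita (a # as) * levi_civita (b # bs) *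
        pd a x u $ i * pd b x u $ k * (D as I * D bs J * H I J))"
      unfolding P[OF \<open>I \<in> ?M\<close>] P[OF \<open>J \<in> ?M\<close>] by (simp add: power2_eq_square)
  qed
  also have "\<dots> = 1 / (fact ?n * (\<rho> u)\<^sup>2) * (\<Sum>I\<in>?M. \<Sum>J\<in>?M.
     (\<Sum>a\<in>UNIV. \<Sum>as\<in>?L. \<Sum>b\<in>UNIV. \<Sum>bs\<in>?L. levi_civita (a # as) * levi_civita (b # bs) *
        pd a x u $ i * pd b x u $ k * (D as I * D bs J * H I J)))"
    by (simp only: sum_distrib_left)
  also have "\<dots> = 1 / (fact ?n * (\<rho> u)\<^sup>2) *
     (\<Sum>a\<in>UNIV. \<Sum>as\<in>?L. \<Sum>b\<in>UNIV. \<Sum>bs\<in>?L. levi_civita (a # as) * levi_civita (b # bs) *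
        pd a x u $ i * pd b x u $ k * (\<Sum>I\<in>?M. \<Sum>J\<in>?M. D as I * D bs J * H I J))"
    unfolding sum_distrib_left sum.swap[of _ "UNIV :: 'n set" ?M] sum.swap[of _ ?L ?M] ..
  also have "\<dots> = 1 / (fact ?n * (\<rho> u)\<^sup>2) *
     (\<Sum>a\<in>UNIV. \<Sum>b\<in>UNIV. pd a x u $ i * pd b x u $ k * (\<Sum>as\<in>?L. \<Sum>bs\<in>?L.
       levi_civita (a # as) * levi_civita (b # bs) * (\<Prod>r<?n. ?g $ (as ! r) $ (bs ! r))))"
    unfolding contract sum_distrib_left sum.swap[of _ "UNIV :: 'n set" ?L] by (simp add: mult_ac)
  also have "\<dots> = 1 / (fact ?n * (\<rho> u)\<^sup>2) *
     (\<Sum>a\<in>UNIV. \<Sum>b\<in>UNIV. fact ?n * det ?g * (matrix_inv ?g $ a $ b * pd a x u $ i * pd b x u $ k))"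
    unfolding levi_civita_cofactors[OF sym inv] by (simp add: mult_ac)
  also have "\<dots> = det ?g / (\<rho> u)\<^sup>2 *
     (\<Sum>a\<in>UNIV. \<Sum>b\<in>UNIV. matrix_inv ?g $ a $ b * pd a x u $ i * pd b x u $ k)"
    unfolding sum_distrib_left[symmetric] by simp
  finally show ?thesis
    using det by (simp add: gamma_def power_divide)
qed

text \<open>
  The matrix $g^{ab}(\partial_ax^i)(\partial_bx^k)\bar g_{kj}$ is the orthogonal projection onto the
  tangent space.
\<close>

lemma P2_mixed_projection:
  fixes x :: "'n::{finite, linorder} coords \<Rightarrow> real^'m::finite"
  assumes "submanifold_patch G U x V N" and u: "u \<in> V"
  shows "(\<chi> i. \<Sum>j\<in>UNIV. P2_mixed G x \<rho> i j u * w $ j)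
    = (gamma G x \<rho> u)\<^sup>2 *\<^sub>R pushforward x u (submanifold_patch.tangent_coords G x u w)"
proof (rule vec_eq_iff[THEN iffD2], intro allI)
  interpret submanifold_patch G U x V N by fact
  fix i
  let ?I = "matrix_inv (g u)"
  have "(\<Sum>j\<in>UNIV. P2_mixed G x \<rho> i j u * w $ j)
      = (\<Sum>j\<in>UNIV. \<Sum>k\<in>UNIV. P2_upper G x \<rho> i k u * (G (x u) $ k $ j * w $ j))"
    by (simp add: P2_mixed_def sum_distrib_right sum_distrib_left mult_ac)
  also have "\<dots> = (\<Sum>k\<in>UNIV. P2_upper G x \<rho> i k u * (G (x u) *v w) $ k)"
    by (subst sum.swap) (simp add: matrix_vector_mult_def sum_distrib_left)
  also have "\<dots> = (\<Sum>k\<in>UNIV. \<Sum>a\<in>UNIV. \<Sum>b\<in>UNIV.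
      (gamma G x \<rho> u)\<^sup>2 * (e a u $ i * (?I $ a $ b * (e b u $ k * (G (x u) *v w) $ k))))"
    unfolding P2_upper_eq[OF differentiable_x[OF u] g_sym[OF u] g_invertible[OF u] less_imp_le[OF det_g_pos[OF u]]]
    by (simp add: sum_distrib_left sum_distrib_right mult_ac)
  also have "\<dots> = (\<Sum>a\<in>UNIV. \<Sum>b\<in>UNIV. \<Sum>k\<in>UNIV.
      (gamma G x \<rho> u)\<^sup>2 * (e a u $ i * (?I $ a $ b * (e b u $ k * (G (x u) *v w) $ k))))"
    unfolding sum.swap[of _ "UNIV :: 'n set" "UNIV :: 'm set"] ..
  also have "\<dots> = (gamma G x \<rho> u)\<^sup>2 * (\<Sum>a\<in>UNIV. e a u $ i * (\<Sum>b\<in>UNIV. ?I $ a $ b * metric u (e b u) w))"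
    by (simp add: ip_eq_inner inner_vec_def sum_distrib_left)
  also have "\<dots> = (gamma G x \<rho> u)\<^sup>2 * (\<Sum>a\<in>UNIV. e a u $ i * tangent_coords u w $ a)"
    using metric_commute[OF u, of w] by (simp add: tangent_coords_def matrix_vector_mult_def)
  finally show "(\<chi> i. \<Sum>j\<in>UNIV. P2_mixed G x \<rho> i j u * w $ j) $ i
      = ((gamma G x \<rho> u)\<^sup>2 *\<^sub>R pushforward x u (tangent_coords u w)) $ i"
    by (simp add: pushforward_def mult_ac)
qed

text \<open>
  The derivative of the connection matrix has a part that differentiates the Christoffel symbols
  and a part with second derivatives of \<open>x\<close>; the latter is symmetric and drops out. The order of
  $a,b$ in \<open>dGam\<close> is that of the bracket $\{x^k, \bar\Gamma^j_{kj'}\}$, whence the sign.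
\<close>

lemma (in submanifold_patch) curvature_christoffel:
  fixes A :: 'p
  assumes u: "u \<in> V"
  defines "dGam \<equiv> \<lambda>a b. (\<chi> j j'. \<Sum>k\<in>UNIV. e a u $ k * pd b (\<lambda>v. christoffel G j k j' (x v)) u)"
  defines "K \<equiv> \<lambda>a b. dGam a b *v N A u - conn a u *v (conn b u *v N A u)"
  shows "cov a (cov b (N A)) u - cov b (cov a (N A)) u = - (K a b - K b a)"
proof -
  \<comment> \<open>the part with second derivatives of \<open>x\<close>\<close>
  define E where "E a b = (\<chi> j j'. \<Sum>k\<in>UNIV. christoffel G j k j' (x u) * pd a (e b) u $ k)" for a b
  have "pd a (conn b) u $ j $ j' = (dGam b a + E a b) $ j $ j'" for a b j j'
    using u by (simp add: pd_entry[symmetric] differentiable_conn conn_def pd_sum pd_mult differentiable_mult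
        differentiable_christoffel_x differentiable_component differentiable_e pd_component dGam_def E_def
        sum.distrib mult.commute)
  then have "pd a (conn b) u = dGam b a + E a b" for a b by (simp add: vec_eq_iff)
  moreover have "E a b = E b a" unfolding E_def using pd_commute[OF open_V u smooth_x, of a b] by simp
  ultimately show ?thesis
    unfolding curvature_eq[OF u] K_def
    by (simp add: matrix_vector_mult_diff_rdistrib matrix_vector_mult_add_rdistrib)
qed

lemma sum_rotate:
  "(\<Sum>i\<in>I. \<Sum>j\<in>J. \<Sum>k\<in>K. F i j k) = (\<Sum>k\<in>K. \<Sum>i\<in>I. \<Sum>j\<in>J. F i j k)"
proof -
  have "(\<Sum>i\<in>I. \<Sum>j\<in>J. \<Sum>k\<in>K. F i j k) = (\<Sum>i\<in>I. \<Sum>k\<in>K. \<Sum>j\<in>J. F i j k)"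
    by (rule sum.cong[OF refl], rule sum.swap)
  then show ?thesis by (simp only: sum.swap[of _ K I])
qed

text \<open>
  Both sides are the pushforward of $\gamma^2$ times one tangent vector. On the left it is
  $\frac12 T^{ab}\mathcal{W}_A(e_a,e_b)$; on the right it is the tangential part of the contraction of
  $T^{ab}$ with \<open>K\<close>, and $K_{ab} - K_{ba}$ is $-[D_a,D_b]N_A$. The Codazzi-Mainardi equation
  identifies the two.
\<close>

lemma curly_C_patch:
  fixes x :: "'n::{finite, linorder} coords \<Rightarrow> real^'m::finite" and N :: "'p::finite \<Rightarrow> 'n coords \<Rightarrow> real^'m"
  assumes patch: "submanifold_patch G U x V N" and u: "u \<in> V" and n: "CARD('n) \<ge> 2"
  defines "\<Gamma> \<equiv> christoffel G"
  shows "(gamma G x \<rho> u)\<^sup>2 *\<^sub>R pushforward x u (curly_C G x N \<rho> A fs u) =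
    (\<chi> i. \<Sum>j\<in>UNIV. \<Sum>j'\<in>UNIV. P2_mixed G x \<rho> i j u *
       ((\<Sum>k\<in>UNIV. bracket \<rho> ((\<lambda>v. x v $ k) # (\<lambda>v. \<Gamma> j k j' (x v)) # fs) u)
        - (\<Sum>k\<in>UNIV. \<Sum>l\<in>UNIV. \<Sum>m\<in>UNIV.
             bracket \<rho> ((\<lambda>v. x v $ k) # (\<lambda>v. x v $ l) # fs) u
             * \<Gamma> m l j' (x u) * \<Gamma> j k m (x u)))
       * N A u $ j')"
proof -
  interpret submanifold_patch G U x V N by fact
  define T where "T = bracket_tensor \<rho> fs u"
  define dGam where "dGam a b = (\<chi> j j'. \<Sum>k\<in>UNIV. e a u $ k * pd b (\<lambda>v. \<Gamma> j k j' (x v)) u)" for a b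
  define K where "K a b = dGam a b *v N A u - conn a u *v (conn b u *v N A u)" for a b
  define R where "R j j' = (\<Sum>k\<in>UNIV. bracket \<rho> ((\<lambda>v. x v $ k) # (\<lambda>v. \<Gamma> j k j' (x v)) # fs) u)
        - (\<Sum>k\<in>UNIV. \<Sum>l\<in>UNIV. \<Sum>m\<in>UNIV.
             bracket \<rho> ((\<lambda>v. x v $ k) # (\<lambda>v. x v $ l) # fs) u
             * \<Gamma> m l j' (x u) * \<Gamma> j k m (x u))" for j j'
  have curv: "cov a (cov b (N A)) u - cov b (cov a (N A)) u = - (K a b - K b a)" for a b
    using curvature_christoffel[OF u, of a b A] by (simp add: K_def dGam_def \<Gamma>_def)
  have T_swap: "T b a = - T a b" for a b
    unfolding T_def by (rule bracket_tensor_swap)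
  \<comment> \<open>Summing over \<open>k\<close> and \<open>l\<close> turns the Christoffel symbols into connection matrices.\<close>
  have R_eq: "R j j' = (\<Sum>a\<in>UNIV. \<Sum>b\<in>UNIV. T a b * (dGam a b - conn a u ** conn b u) $ j $ j')" for j j'
  proof -
    have "(\<Sum>k\<in>UNIV. bracket \<rho> ((\<lambda>v. x v $ k) # (\<lambda>v. \<Gamma> j k j' (x v)) # fs) u)
        = (\<Sum>k\<in>UNIV. \<Sum>a\<in>UNIV. \<Sum>b\<in>UNIV. T a b * (e a u $ k * pd b (\<lambda>v. \<Gamma> j k j' (x v)) u))"
      using u by (simp add: bracket_Cons_Cons[OF n] T_def pd_component differentiable_x)
    also have "\<dots> = (\<Sum>a\<in>UNIV. \<Sum>b\<in>UNIV. T a b * dGam a b $ j $ j')"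
      unfolding sum.swap[of _ "UNIV :: 'n set" "UNIV :: 'm set"] by (simp add: dGam_def sum_distrib_left)
    finally have 1: "(\<Sum>k\<in>UNIV. bracket \<rho> ((\<lambda>v. x v $ k) # (\<lambda>v. \<Gamma> j k j' (x v)) # fs) u)
        = (\<Sum>a\<in>UNIV. \<Sum>b\<in>UNIV. T a b * dGam a b $ j $ j')" .
    have "(\<Sum>k\<in>UNIV. \<Sum>l\<in>UNIV. \<Sum>m\<in>UNIV. bracket \<rho> ((\<lambda>v. x v $ k) # (\<lambda>v. x v $ l) # fs) u
             * \<Gamma> m l j' (x u) * \<Gamma> j k m (x u))
        = (\<Sum>k\<in>UNIV. \<Sum>l\<in>UNIV. \<Sum>m\<in>UNIV. \<Sum>a\<in>UNIV. \<Sum>b\<in>UNIV.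
             T a b * ((\<Gamma> j k m (x u) * e a u $ k) * (\<Gamma> m l j' (x u) * e b u $ l)))"
      using u by (simp add: bracket_Cons_Cons[OF n] T_def pd_component differentiable_x sum_distrib_right
          sum_distrib_left mult_ac)
    also have "\<dots> = (\<Sum>a\<in>UNIV. \<Sum>b\<in>UNIV. \<Sum>k\<in>UNIV. \<Sum>l\<in>UNIV. \<Sum>m\<in>UNIV.
             T a b * ((\<Gamma> j k m (x u) * e a u $ k) * (\<Gamma> m l j' (x u) * e b u $ l)))"
      unfolding sum.swap[of _ "UNIV :: 'n set" "UNIV :: 'm set"] ..
    also have "\<dots> = (\<Sum>a\<in>UNIV. \<Sum>b\<in>UNIV. \<Sum>m\<in>UNIV. \<Sum>k\<in>UNIV. \<Sum>l\<in>UNIV.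
             T a b * ((\<Gamma> j k m (x u) * e a u $ k) * (\<Gamma> m l j' (x u) * e b u $ l)))"
      by (rule sum.cong[OF refl], rule sum.cong[OF refl], rule sum_rotate)
    also have "\<dots> = (\<Sum>a\<in>UNIV. \<Sum>b\<in>UNIV. T a b * (conn a u ** conn b u) $ j $ j')"
      by (simp add: conn_def matrix_matrix_mult_def \<Gamma>_def sum_product) (simp add: sum_distrib_left)
    finally show ?thesis
      unfolding R_def 1 by (simp add: sum_subtractf right_diff_distrib)
  qed
  have R_N: "(\<chi> j. \<Sum>j'\<in>UNIV. R j j' * N A u $ j') = (\<Sum>a\<in>UNIV. \<Sum>b\<in>UNIV. T a b *\<^sub>R K a b)"
  proof (rule vec_eq_iff[THEN iffD2], intro allI)
    fix j
    have "K a b = (dGam a b - conn a u ** conn b u) *v N A u" for a b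
      by (simp add: K_def matrix_vector_mult_diff_rdistrib matrix_vector_mul_assoc)
    then have K: "K a b $ j = (\<Sum>j'\<in>UNIV. (dGam a b - conn a u ** conn b u) $ j $ j' * N A u $ j')" for a b
      by (simp add: matrix_vector_mult_def)
    have "(\<Sum>j'\<in>UNIV. R j j' * N A u $ j') = (\<Sum>j'\<in>UNIV. \<Sum>a\<in>UNIV. \<Sum>b\<in>UNIV.
        T a b * ((dGam a b - conn a u ** conn b u) $ j $ j' * N A u $ j'))"
      unfolding R_eq sum_distrib_right by (simp only: mult.assoc)
    also have "\<dots> = (\<Sum>a\<in>UNIV. \<Sum>b\<in>UNIV. T a b * K a b $ j)"
      unfolding sum.swap[of _ "UNIV :: 'n set" "UNIV :: 'm set"] K sum_distrib_left ..
    finally show "(\<chi> j. \<Sum>j'\<in>UNIV. R j j' * N A u $ j') $ j = (\<Sum>a\<in>UNIV. \<Sum>b\<in>UNIV. T a b *\<^sub>R K a b) $ j"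
      by simp
  qed
  have W: "curly_W G x N A (\<lambda>_. axis a 1) (\<lambda>_. axis b 1) u = tangent_coords u (K a b - K b a)" for a b
    unfolding codazzi[OF u] curv linear_neg[OF linear_tangent_coords] by (rule minus_minus)
  have "curly_C G x N \<rho> A fs u = (1/2) *\<^sub>R (\<Sum>a\<in>UNIV. \<Sum>b\<in>UNIV. T a b *\<^sub>R tangent_coords u (K a b - K b a))"
    unfolding curly_C_eq W T_def ..
  also have "\<dots> = tangent_coords u ((1/2) *\<^sub>R (\<Sum>a\<in>UNIV. \<Sum>b\<in>UNIV. T a b *\<^sub>R (K a b - K b a)))"
    by (simp add: linear_cmul[OF linear_tangent_coords] linear_sum[OF linear_tangent_coords])
  also have "\<dots> = tangent_coords u (\<chi> j. \<Sum>j'\<in>UNIV. R j j' * N A u $ j')"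
    unfolding R_N by (subst sum_antisymmetric[of T K, OF T_swap]) (rule refl)
  finally have "(gamma G x \<rho> u)\<^sup>2 *\<^sub>R pushforward x u (curly_C G x N \<rho> A fs u)
      = (\<chi> i. \<Sum>j\<in>UNIV. P2_mixed G x \<rho> i j u * (\<chi> j. \<Sum>j'\<in>UNIV. R j j' * N A u $ j') $ j)"
    unfolding P2_mixed_projection[OF patch u] by simp
  then show ?thesis
    unfolding R_def[symmetric] by (simp add: sum_distrib_left mult.assoc)
qed

section \<open>The identity in charts of embedded manifolds\<close>

lemma submanifold_patch_chart:
  fixes \<S> :: "('s::topological_space, 'n::finite) chart set" and \<M> :: "('a::topological_space, 'm::finite) chart set"
    and N :: "'p::finite \<Rightarrow> 'n coords \<Rightarrow> real^'m"
  assumes codim: "CARD('m) = CARD('n) + CARD('p)"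
    and atlas: "smooth_atlas \<S>" "smooth_atlas \<M>"
    and G: "riemannian_metric \<M> G" and emb: "smooth_embedding \<S> \<M> \<iota>"
    and d: "d \<in> \<S>" and c: "c \<in> \<M>"
    and V: "open V" "V \<subseteq> overlap \<iota> d c"
    and N: "orthonormal_normal_fields (G c) (coord_rep \<iota> d c) N V"
  shows "submanifold_patch (G c) (snd c ` fst c) (coord_rep \<iota> d c) V N"
proof
  let ?U = "snd c ` fst c"
  show "open ?U" using atlas(2) c by (auto simp: smooth_atlas_def is_chart_def)
  show "coord_rep \<iota> d c v \<in> ?U" if "v \<in> V" for v
  proof -
    obtain s where s: "s \<in> fst d" "\<iota> s \<in> fst c" "v = snd d s"
      using \<open>v \<in> V\<close> V(2) by (auto simp: overlap_def)
    have "chart_inv d v = s"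
      using atlas(1) d s by (auto simp: smooth_atlas_def is_chart_def homeomorphism_def)
    then show ?thesis using s by (simp add: coord_rep_def)
  qed
  show "smooth_on ?U (G c)"
    using G c by (auto simp: riemannian_metric_def)
  show "transpose (G c y) = G c y" if "y \<in> ?U" for y
    using G c that by (auto simp: riemannian_metric_def)
  show "w \<bullet> (G c y *v w) > 0" if "y \<in> ?U" "w \<noteq> 0" for y w
    using G c that by (auto simp: riemannian_metric_def)
  show "smooth_on V (coord_rep \<iota> d c)"
    using emb d c by (intro smooth_on_subset[OF _ V(2)]) (simp add: smooth_embedding_def)
  show "inj (frechet_derivative (coord_rep \<iota> d c) (at v))" if "v \<in> V" for v
    using emb d c V(2) that by (auto simp: smooth_embedding_def)
qed (use V N codim in auto)

theorem theorem5p6: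
  fixes \<S> :: "('s::{t2_space, second_countable_topology}, 'n::{finite, linorder}) chart set"
    and \<M> :: "('a::{t2_space, second_countable_topology}, 'm::finite) chart set"
    and G :: "('a, 'm) chart \<Rightarrow> real^'m \<Rightarrow> real^'m^'m"
    and \<iota> :: "'s \<Rightarrow> 'a"
    and d :: "('s, 'n) chart" and c :: "('a, 'm) chart"
    and x :: "'n coords \<Rightarrow> real^'m" and Gbar :: "real^'m \<Rightarrow> real^'m^'m"
    and \<Gamma> :: "'m \<Rightarrow> 'm \<Rightarrow> 'm \<Rightarrow> real^'m \<Rightarrow> real"
    and V :: "('n coords) set"
    and N :: "'p::finite \<Rightarrow> 'n coords \<Rightarrow> real^'m"
    and \<rho> :: "'n coords \<Rightarrow> real"
    and fs :: "('s \<Rightarrow> real) list" and fs' :: "('n coords \<Rightarrow> real) list"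
    and A :: 'p and u :: "'n coords"
  assumes "CARD('n) \<ge> 2" and "CARD('m) = CARD('n) + CARD('p)"
    and "smooth_atlas \<S>" and "smooth_atlas \<M>"
    and "riemannian_metric \<M> G"
    and "smooth_embedding \<S> \<M> \<iota>"
    and "d \<in> \<S>" and "c \<in> \<M>"
    and "x = coord_rep \<iota> d c" and "Gbar = G c" and "\<Gamma> = christoffel Gbar"
    and "open V" and "V \<subseteq> overlap \<iota> d c"
    and "orthonormal_normal_fields Gbar x N V"
    and "smooth_on V \<rho>" and "\<forall>v\<in>V. \<rho> v \<noteq> 0"
    and "length fs = CARD('n) - 2" and "\<forall>f\<in>set fs. smooth_function \<S> f"
    and "fs' = map (\<lambda>f. f \<circ> chart_inv d) fs"
    and "u \<in> V"
  shows "(gamma Gbar x \<rho> u)\<^sup>2 *\<^sub>R pushforward x u (curly_C Gbar x N \<rho> A fs' u) =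
    (\<chi> i. \<Sum>j\<in>UNIV. \<Sum>j'\<in>UNIV. P2_mixed Gbar x \<rho> i j u *
       ((\<Sum>k\<in>UNIV. bracket \<rho> ((\<lambda>v. x v $ k) # (\<lambda>v. \<Gamma> j k j' (x v)) # fs') u)
        - (\<Sum>k\<in>UNIV. \<Sum>l\<in>UNIV. \<Sum>m\<in>UNIV.
             bracket \<rho> ((\<lambda>v. x v $ k) # (\<lambda>v. x v $ l) # fs') u
             * \<Gamma> m l j' (x u) * \<Gamma> j k m (x u)))
       * N A u $ j')"
proof -
  have "submanifold_patch Gbar (snd c ` fst c) x V N"
    using submanifold_patch_chart[OF assms(2-8,12,13)] assms(9,10,14) by simp
  from curly_C_patch[OF this \<open>u \<in> V\<close> assms(1)] show ?thesis
    by (simp only: assms(11))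
qed

end
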